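(* In Pandora's Matching Problem, the Best-of-Two-Worlds algorithm achieves at least a $1/4$-approximation of the optimal welfare: for every instance, its expected welfare is at least $\tfrac14 \mathrm{Welfare}(\textsc{Opt})$.
   Context: Pandora's Matching Problem. An instance consists of a finite undirected graph $G=(V,E)$, not necessarily bipartite, and, for each edge $\{i,j\}\in E$, two Pandora boxes: box $(i,j)$ with a known distribution $D_{ij}$ over $\mathbb{R}$ (with finite mean) and a known cost $c_{ij}\ge 0$, and box $(j,i)$ with $D_{ji}$ and $c_{ji}\ge 0$. The values $v_{ij}\sim D_{ij}$ are drawn independently over all boxes. An algorithm repeatedly chooses an unopened box $(i,j)$, pays $c_{ij}$ and observes $v_{ij}$; its choices may depend on everything observed so far (and on internal randomness). Eventually it stops and outputs a matching of $G$ consisting only of edges both of whose boxes have been opened. Let $\mathbb{I}_{ij}$ indicate that box $(i,j)$ was opened and $\mathbb{A}_{ij}=\mathbb{A}_{ji}$ indicate that $\{i,j\}$ is in the output matching. The welfare of an algorithm is $\mathrm{Welfare}=\mathbb{E}\big[\sum_{(i,j)}(\mathbb{A}_{ij}v_{ij}-\mathbb{I}_{ij}c_{ij})\big]$, the sum over all boxes. $\textsc{Opt}$ denotes a welfare-maximizing algorithm. Orientations and nested indices. An orientation $\mathcal{O}$ of $G$ is a set of ordered pairs containing, for each edge $\{i,j\}$, exactly one of $(i,j)$, $(j,i)$; its reverse is $\hat{\mathcal{O}}=\{(j,i):(i,j)\in\mathcal{O}\}$. For $(i,j)\in\mathcal{O}$ the edge is treated as a two-stage basket: stage 1 opens box $(i,j)$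 (cost $c_{ij}$, reveals $v_{ij}$), stage 2 opens box $(j,i)$ (cost $c_{ji}$, reveals the total $v_{ij}+v_{ji}$), and advancing the basket once both boxes are open means adding $\{i,j\}$ to the matching. Its indices are defined by backward induction: $\sigma^{(3)}_{ij}=\kappa^{(3)}_{ij}=v_{ij}+v_{ji}$; $\sigma^{(2)}_{ij}$ is the function of $v_{ij}$ that solves $\mathbb{E}[(\kappa^{(3)}_{ij}-\sigma^{(2)}_{ij})^+\mid v_{ij}]=c_{ji}$, and $\kappa^{(2)}_{ij}=\min(\sigma^{(2)}_{ij},\kappa^{(3)}_{ij})$; $\sigma^{(1)}_{ij}$ is the real number solving $\mathbb{E}[(\kappa^{(2)}_{ij}-\sigma^{(1)}_{ij})^+]=c_{ij}$. Here $(x)^+=\max(x,0)$. The current Weitzman index of the basket is $\sigma^{(1)}_{ij}$ if no box of the edge is open, $\sigma^{(2)}_{ij}$ if only $(i,j)$ is open, and $\sigma^{(3)}_{ij}$ if both are open. $\mathcal{O}$-Oriented Descending Procedure: maintain a set $S$ (initially $\mathcal{O}$) and a matching $M$ (initially empty). Repeatedly: if $S$ is empty or the largest current index among baskets in $S$ is negative, stop and output $M$; otherwise advance the basket $(i,j)\in S$ with the largest current index (open its next box, or, if both boxes are open, add $\{i,j\}$ to $M$ and delete from $S$ all oriented edges incident to $i$ or $j$). Best-of-Two-Worlds algorithm: pick an arbitrary orientation $\mathcal{O}$, compute the expected welfare of the $\mathcal{O}$-Oriented Descending Procedure and of the $\hat{\mathcal{O}}$-Oriented Descending Procedure, and run the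 one with the larger expected welfare. *)

theory Defs
  imports "HOL-Probability.Probability" "HOL-Library.While_Combinator" "HOL-Library.Disjoint_Sets"
begin

record 'v pandora =
  verts :: "'v set"
  edges :: "'v set set"
  dist_of :: "'v \<times> 'v \<Rightarrow> real measure"
  cost :: "'v \<times> 'v \<Rightarrow> real"

definition boxes :: "'v pandora \<Rightarrow> ('v \<times> 'v) set" where
  "boxes P = {(i, j). {i, j} \<in> edges P}"

definition pandora_instance :: "'v pandora \<Rightarrow> bool" where
  "pandora_instance P \<longleftrightarrow>
     finite (verts P) \<and>
     (\<forall>e \<in> edges P. e \<subseteq> verts P \<and> card e = 2) \<and>
     (\<forall>b \<in> boxes P. prob_space (dist_of P b) \<and> sets (dist_of P b) = sets borel \<and>
        integrable (dist_of P b) (\<lambda>x. x) \<and> 0 \<le> cost P b)"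

definition value_measure :: "'v pandora \<Rightarrow> ('v \<times> 'v \<Rightarrow> real) measure" where
  "value_measure P = PiM (boxes P) (dist_of P)"

definition is_matching :: "'v pandora \<Rightarrow> 'v set set \<Rightarrow> bool" where
  "is_matching P M \<longleftrightarrow> M \<subseteq> edges P \<and> disjoint M"

text \<open>An outcome is the list of opened boxes together with the output matching.\<close>

definition payoff ::
    "'v pandora \<Rightarrow> ('v \<times> 'v \<Rightarrow> real) \<Rightarrow> ('v \<times> 'v) list \<times> 'v set set \<Rightarrow> real" where
  "payoff P v = (\<lambda>(bs, M). \<Sum>(i, j) \<in> boxes P.
     of_bool ({i, j} \<in> M) * v (i, j) - of_bool ((i, j) \<in> set bs) * cost P (i, j))"

text \<open>A history lists the opened boxes with the values found in them, in order of opening.\<close>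

type_synonym 'v history = "(('v \<times> 'v) \<times> real) list"

definition observe :: "('v \<times> 'v \<Rightarrow> real) \<Rightarrow> ('v \<times> 'v) list \<Rightarrow> 'v history" where
  "observe v bs = map (\<lambda>b. (b, v b)) bs"

datatype 'v action = is_Open: Open (next_box: "'v \<times> 'v") | Stop (out_matching: "'v set set")

fun legal_action :: "'v pandora \<Rightarrow> ('v \<times> 'v) list \<Rightarrow> 'v action \<Rightarrow> bool" where
  "legal_action P bs (Open b) \<longleftrightarrow> b \<in> boxes P \<and> b \<notin> set bs"
| "legal_action P bs (Stop M) \<longleftrightarrow>
     is_matching P M \<and> (\<forall>i j. {i, j} \<in> M \<longrightarrow> (i, j) \<in> set bs \<and> (j, i) \<in> set bs)"

text \<open>
  Internal randomness is a seed with law \<open>R\<close>, drawn independently of the values; an algorithm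
  maps the seed and the history to its next action.
\<close>

definition is_algorithm ::
    "'v pandora \<Rightarrow> 's measure \<Rightarrow> ('s \<Rightarrow> 'v history \<Rightarrow> 'v action) \<Rightarrow> bool" where
  "is_algorithm P R \<pi> \<longleftrightarrow>
     (\<forall>bs. distinct bs \<and> set bs \<subseteq> boxes P \<longrightarrow>
        (\<forall>s \<in> space R. \<forall>v \<in> space (value_measure P). legal_action P bs (\<pi> s (observe v bs))) \<and>
        (\<lambda>(s, v). \<pi> s (observe v bs))
          \<in> measurable (R \<Otimes>\<^sub>M value_measure P) (count_space UNIV))"

definition run_algorithm ::
    "('v history \<Rightarrow> 'v action) \<Rightarrow> ('v \<times> 'v \<Rightarrow> real) \<Rightarrow> ('v \<times> 'v) list \<times> 'v set set" where
  "run_algorithm \<pi> v =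
     (let bs = while (\<lambda>bs. is_Open (\<pi> (observe v bs)))
                     (\<lambda>bs. bs @ [next_box (\<pi> (observe v bs))]) []
      in (bs, out_matching (\<pi> (observe v bs))))"

definition welfare ::
    "'v pandora \<Rightarrow> 's measure \<Rightarrow> ('s \<Rightarrow> 'v history \<Rightarrow> 'v action) \<Rightarrow> real" where
  "welfare P R \<pi> = (\<integral>(s, v). payoff P v (run_algorithm (\<pi> s) v) \<partial>(R \<Otimes>\<^sub>M value_measure P))"

definition opt_welfare :: "'v pandora \<Rightarrow> 's measure \<Rightarrow> ereal" where
  "opt_welfare P R = (SUP \<pi> \<in> {\<pi>. is_algorithm P R \<pi>}. ereal (welfare P R \<pi>))"

definition is_orientation :: "'v pandora \<Rightarrow> ('v \<times> 'v) set \<Rightarrow> bool" where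
  "is_orientation P Ori \<longleftrightarrow>
     Ori \<subseteq> boxes P \<and> (\<forall>(i, j) \<in> boxes P. (i, j) \<in> Ori \<longleftrightarrow> (j, i) \<notin> Ori)"

definition kappa3 :: "real \<Rightarrow> real \<Rightarrow> ereal" where
  "kappa3 x y = ereal (x + y)"

definition kappa2 :: "(real \<Rightarrow> ereal) \<Rightarrow> real \<Rightarrow> real \<Rightarrow> ereal" where
  "kappa2 s2 x y = min (s2 x) (kappa3 x y)"

text \<open>
  \<open>\<sigma>1 (i, j)\<close> and \<open>\<sigma>2 (i, j) x\<close> (where \<open>x\<close> is the value of box \<open>(i, j)\<close>) are the indices of the
  basket whose first stage is \<open>(i, j)\<close>. As the values are independent, conditioning on
  \<open>v (i, j) = x\<close> leaves an expectation over the law of box \<open>(j, i)\<close>.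

  For a positive cost the solution of an index equation is a unique real number. For cost 0
  the solutions are the upper bounds of the essential supremum, and when that is infinite the
  only solution is \<open>\<infinity>\<close>; hence the indices are extended reals, and any solution is admitted.
  No solution is \<open>-\<infinity>\<close>, since then the left-hand side is infinite.
\<close>

definition are_indices ::
    "'v pandora \<Rightarrow> ('v \<times> 'v \<Rightarrow> ereal) \<Rightarrow> ('v \<times> 'v \<Rightarrow> real \<Rightarrow> ereal) \<Rightarrow> bool" where
  "are_indices P \<sigma>1 \<sigma>2 \<longleftrightarrow>
     (\<forall>(i, j) \<in> boxes P.
        \<sigma>2 (i, j) \<in> borel_measurable borel \<and>
        (\<forall>x. (\<integral>\<^sup>+ y. e2ennreal (max 0 (kappa3 x y - \<sigma>2 (i, j) x)) \<partial>dist_of P (j, i))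
               = ennreal (cost P (j, i))) \<and>
        (\<integral>\<^sup>+ v. e2ennreal (max 0 (kappa2 (\<sigma>2 (i, j)) (v (i, j)) (v (j, i)) - \<sigma>1 (i, j)))
            \<partial>value_measure P) = ennreal (cost P (i, j)))"

definition current_index ::
    "('v \<times> 'v \<Rightarrow> ereal) \<Rightarrow> ('v \<times> 'v \<Rightarrow> real \<Rightarrow> ereal) \<Rightarrow> 'v history \<Rightarrow> 'v \<times> 'v \<Rightarrow> ereal" where
  "current_index \<sigma>1 \<sigma>2 h = (\<lambda>(i, j).
     case map_of h (i, j) of
       None \<Rightarrow> \<sigma>1 (i, j)
     | Some x \<Rightarrow> (case map_of h (j, i) of
           None \<Rightarrow> \<sigma>2 (i, j) x
         | Some y \<Rightarrow> kappa3 x y))"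

text \<open>
  A selection rule picks a basket of largest current index in \<open>S\<close>; ties may be broken
  arbitrarily, but only on the basis of what has been observed. Since nonempty subsets of an
  orientation and of its reverse are never equal, one rule can break ties independently in
  the two procedures.
\<close>

definition is_selection ::
    "'v pandora \<Rightarrow> ('v \<times> 'v \<Rightarrow> ereal) \<Rightarrow> ('v \<times> 'v \<Rightarrow> real \<Rightarrow> ereal) \<Rightarrow>
     ('v history \<Rightarrow> ('v \<times> 'v) set \<Rightarrow> 'v \<times> 'v) \<Rightarrow> bool" where
  "is_selection P \<sigma>1 \<sigma>2 sel \<longleftrightarrow>
     (\<forall>S. S \<noteq> {} \<and> S \<subseteq> boxes P \<longrightarrow>
        (\<forall>h. sel h S \<in> S \<and>
             (\<forall>b \<in> S. current_index \<sigma>1 \<sigma>2 h b \<le> current_index \<sigma>1 \<sigma>2 h (sel h S))) \<and>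
        (\<forall>bs. distinct bs \<and> set bs \<subseteq> boxes P \<longrightarrow>
             (\<lambda>v. sel (observe v bs) S) \<in> measurable (value_measure P) (count_space UNIV)))"

text \<open>A state consists of the opened boxes, the set \<open>S\<close> and the matching \<open>M\<close>.\<close>

type_synonym 'v state = "('v \<times> 'v) list \<times> ('v \<times> 'v) set \<times> 'v set set"

definition descending_continues ::
    "('v \<times> 'v \<Rightarrow> ereal) \<Rightarrow> ('v \<times> 'v \<Rightarrow> real \<Rightarrow> ereal) \<Rightarrow> ('v \<times> 'v \<Rightarrow> real) \<Rightarrow>
     'v state \<Rightarrow> bool" where
  "descending_continues \<sigma>1 \<sigma>2 v = (\<lambda>(bs, S, M).
     S \<noteq> {} \<and> \<not> Max (current_index \<sigma>1 \<sigma>2 (observe v bs) ` S) < 0)"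

definition descending_step ::
    "('v history \<Rightarrow> ('v \<times> 'v) set \<Rightarrow> 'v \<times> 'v) \<Rightarrow> ('v \<times> 'v \<Rightarrow> real) \<Rightarrow> 'v state \<Rightarrow> 'v state" where
  "descending_step sel v = (\<lambda>(bs, S, M).
     let (i, j) = sel (observe v bs) S in
       if (i, j) \<notin> set bs then (bs @ [(i, j)], S, M)
       else if (j, i) \<notin> set bs then (bs @ [(j, i)], S, M)
       else (bs, {(k, l) \<in> S. {k, l} \<inter> {i, j} = {}}, insert {i, j} M))"

definition run_descending ::
    "('v \<times> 'v \<Rightarrow> ereal) \<Rightarrow> ('v \<times> 'v \<Rightarrow> real \<Rightarrow> ereal) \<Rightarrow>
     ('v history \<Rightarrow> ('v \<times> 'v) set \<Rightarrow> 'v \<times> 'v) \<Rightarrow> ('v \<times> 'v) set \<Rightarrow>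
     ('v \<times> 'v \<Rightarrow> real) \<Rightarrow> ('v \<times> 'v) list \<times> 'v set set" where
  "run_descending \<sigma>1 \<sigma>2 sel Ori v =
     (let (bs, S, M) = while (descending_continues \<sigma>1 \<sigma>2 v) (descending_step sel v) ([], Ori, {})
      in (bs, M))"

definition descending_welfare ::
    "'v pandora \<Rightarrow> ('v \<times> 'v \<Rightarrow> ereal) \<Rightarrow> ('v \<times> 'v \<Rightarrow> real \<Rightarrow> ereal) \<Rightarrow>
     ('v history \<Rightarrow> ('v \<times> 'v) set \<Rightarrow> 'v \<times> 'v) \<Rightarrow> ('v \<times> 'v) set \<Rightarrow> real" where
  "descending_welfare P \<sigma>1 \<sigma>2 sel Ori =
     (\<integral>v. payoff P v (run_descending \<sigma>1 \<sigma>2 sel Ori v) \<partial>value_measure P)"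

definition run_best_of_two_worlds ::
    "'v pandora \<Rightarrow> ('v \<times> 'v \<Rightarrow> ereal) \<Rightarrow> ('v \<times> 'v \<Rightarrow> real \<Rightarrow> ereal) \<Rightarrow>
     ('v history \<Rightarrow> ('v \<times> 'v) set \<Rightarrow> 'v \<times> 'v) \<Rightarrow> ('v \<times> 'v) set \<Rightarrow>
     ('v \<times> 'v \<Rightarrow> real) \<Rightarrow> ('v \<times> 'v) list \<times> 'v set set" where
  "run_best_of_two_worlds P \<sigma>1 \<sigma>2 sel Ori =
     (if descending_welfare P \<sigma>1 \<sigma>2 sel (Ori\<inverse>) \<le> descending_welfare P \<sigma>1 \<sigma>2 sel Ori
      then run_descending \<sigma>1 \<sigma>2 sel Ori
      else run_descending \<sigma>1 \<sigma>2 sel (Ori\<inverse>))"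

definition best_of_two_worlds_welfare ::
    "'v pandora \<Rightarrow> ('v \<times> 'v \<Rightarrow> ereal) \<Rightarrow> ('v \<times> 'v \<Rightarrow> real \<Rightarrow> ereal) \<Rightarrow>
     ('v history \<Rightarrow> ('v \<times> 'v) set \<Rightarrow> 'v \<times> 'v) \<Rightarrow> ('v \<times> 'v) set \<Rightarrow> real" where
  "best_of_two_worlds_welfare P \<sigma>1 \<sigma>2 sel Ori =
     (\<integral>v. payoff P v (run_best_of_two_worlds P \<sigma>1 \<sigma>2 sel Ori v) \<partial>value_measure P)"

end

theory Submission imports Defs begin

text \<open>
  Write \<open>\<kappa>1\<close> for the minimum of all three indices of a basket, \<open>\<kappa>2\<close> for the minimum of the last two,
  and \<open>\<kappa>3\<close> for the last. The index equations say that the cost of the first box is the mean of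
  \<open>\<kappa>2 - \<kappa>1\<close>, and the cost of the second box the conditional mean of \<open>\<kappa>3 - \<kappa>2\<close>. The decision to open
  a box is independent of what is still hidden, so in expectation every cost may be
  replaced by the corresponding difference. Hence, if each edge is oriented by the order in which an
  algorithm opens its boxes, the welfare of that algorithm is at most the expected \<open>\<kappa>1\<close>-weight of
  its matching. This matching splits into a part oriented along \<open>Ori\<close> and a part oriented along the
  reverse.

  For the descending procedure the bound is an equality: a basket whose index
  rises after a box is opened stays on top until it is matched, so no difference is paid for an
  unmatched edge. Moreover the procedure builds a greedy matching for the weights \<open>\<kappa>1\<close>, which has at
  least half the weight of any other matching. The two procedures together thus earn at least half
  of the optimum, and the better one a quarter.
\<close>

section \<open>Loops\<close>

lemma while_eq_funpow:
  fixes rank :: "'s \<Rightarrow> nat"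
  assumes step: "\<And>s. I s \<Longrightarrow> b s \<Longrightarrow> I (c s) \<and> rank (c s) < rank s"
    and "I s" "rank s \<le> n"
  shows "while b c s = ((\<lambda>s. if b s then c s else s) ^^ n) s"
  using assms(2,3)
proof (induction n arbitrary: s)
  case 0
  then have "\<not> b s" using step by fastforce
  then show ?case by (simp add: while_unfold)
next
  case (Suc n)
  let ?f = "\<lambda>s. if b s then c s else s"
  show ?case
  proof (cases "b s")
    case True
    then have "while b c s = while b c (c s)" by (simp add: while_unfold[of b c s])
    also have "\<dots> = (?f ^^ n) (c s)"
      using step[OF Suc.prems(1) True] Suc.prems(2) by (intro Suc.IH) auto
    finally show ?thesis using True by (simp add: funpow_swap1[of ?f n s])
  next
    case False
    then have "(?f ^^ n) s = s" for n by (induction n) simp_all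
    then show ?thesis using False by (simp only: while_unfold[of b c s] if_False)
  qed
qed

section \<open>Independence in finite product spaces\<close>

definition ignores_coords :: "'i set \<Rightarrow> ('i \<Rightarrow> 'a) set \<Rightarrow> (('i \<Rightarrow> 'a) \<Rightarrow> 'c) \<Rightarrow> bool" where
  "ignores_coords J \<Omega> f \<longleftrightarrow>
     (\<forall>v \<in> \<Omega>. \<forall>v' \<in> \<Omega>. (\<forall>i. i \<notin> J \<longrightarrow> v i = v' i) \<longrightarrow> f v = f v')"

lemma ignores_coordsI:
  "(\<And>v v'. v \<in> \<Omega> \<Longrightarrow> v' \<in> \<Omega> \<Longrightarrow> (\<And>i. i \<notin> J \<Longrightarrow> v i = v' i) \<Longrightarrow> f v = f v') \<Longrightarrow> ignores_coords J \<Omega> f"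
  unfolding ignores_coords_def by blast

lemma ignores_coordsD:
  "ignores_coords J \<Omega> f \<Longrightarrow> v \<in> \<Omega> \<Longrightarrow> v' \<in> \<Omega> \<Longrightarrow> (\<And>i. i \<notin> J \<Longrightarrow> v i = v' i) \<Longrightarrow> f v = f v'"
  unfolding ignores_coords_def by blast

lemma ignores_coords_mono: "ignores_coords J \<Omega> f \<Longrightarrow> K \<subseteq> J \<Longrightarrow> ignores_coords K \<Omega> f"
  unfolding ignores_coords_def by blast

lemma ignores_coords_conj:
  "ignores_coords J \<Omega> A \<Longrightarrow> ignores_coords J \<Omega> B \<Longrightarrow> ignores_coords J \<Omega> (\<lambda>v. A v \<and> B v)"
  unfolding ignores_coords_def by blast

context finite_product_prob_space
begin

lemma nn_integral_PiM_split:
  assumes "J \<subseteq> I" "f \<in> borel_measurable (Pi\<^sub>M I M)"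
  shows "(\<integral>\<^sup>+ v. f v \<partial>Pi\<^sub>M I M)
    = (\<integral>\<^sup>+ x. (\<integral>\<^sup>+ y. f (merge (I - J) J (x, y)) \<partial>Pi\<^sub>M J M) \<partial>Pi\<^sub>M (I - J) M)"
proof -
  have "finite J" using finite_index assms(1) by (rule finite_subset[rotated])
  then show ?thesis
    using product_nn_integral_fold[of "I - J" J f] assms finite_index
    by (simp add: Un_absorb2 Diff_disjoint Int_commute)
qed

lemma nn_integral_event_const_fibre:
  assumes subset: "J \<subseteq> I"
    and [measurable]: "h \<in> borel_measurable (Pi\<^sub>M I M)" "Measurable.pred (Pi\<^sub>M I M) E"
    and event: "ignores_coords J (space (Pi\<^sub>M I M)) E"
    and fibre: "\<And>x. x \<in> space (Pi\<^sub>M (I - J) M) \<Longrightarrow>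
      (\<integral>\<^sup>+ y. h (merge (I - J) J (x, y)) \<partial>Pi\<^sub>M J M) = c"
  shows "(\<integral>\<^sup>+ v. of_bool (E v) * h v \<partial>Pi\<^sub>M I M)
    = c * emeasure (Pi\<^sub>M I M) {v \<in> space (Pi\<^sub>M I M). E v}"
proof -
  interpret J: prob_space "Pi\<^sub>M J M" by (intro prob_space_PiM prob_space)
  let ?m = "merge (I - J) J"
  have merge_space: "?m (x, y) \<in> space (Pi\<^sub>M I M)"
    if "x \<in> space (Pi\<^sub>M (I - J) M)" "y \<in> space (Pi\<^sub>M J M)" for x y
    using subset that by (fastforce simp: space_PiM PiE_iff merge_def extensional_def)
  have "(\<integral>\<^sup>+ y. of_bool (E (?m (x, y))) * h (?m (x, y)) \<partial>Pi\<^sub>M J M)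
      = (\<integral>\<^sup>+ y. c * of_bool (E (?m (x, y))) \<partial>Pi\<^sub>M J M)"
    if in_space: "x \<in> space (Pi\<^sub>M (I - J) M)" for x
  proof -
    obtain y0 where y0: "y0 \<in> space (Pi\<^sub>M J M)" using J.not_empty by blast
    have "E (?m (x, y)) = E (?m (x, y0))" if "y \<in> space (Pi\<^sub>M J M)" for y
      using in_space that y0 by (intro ignores_coordsD[OF event] merge_space) (auto simp: merge_def)
    then have "?thesis \<longleftrightarrow> (\<integral>\<^sup>+ y. of_bool (E (?m (x, y0))) * h (?m (x, y)) \<partial>Pi\<^sub>M J M)
        = (\<integral>\<^sup>+ y. c * of_bool (E (?m (x, y0))) \<partial>Pi\<^sub>M J M)"
      by (intro arg_cong2[of _ _ _ _ "(=)"] nn_integral_cong) simp_all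
    then show ?thesis
      using fibre[OF in_space] by (simp add: J.emeasure_space_1)
  qed
  then have "(\<integral>\<^sup>+ v. of_bool (E v) * h v \<partial>Pi\<^sub>M I M) = (\<integral>\<^sup>+ v. c * of_bool (E v) \<partial>Pi\<^sub>M I M)"
    by (simp add: nn_integral_PiM_split[OF subset] cong: nn_integral_cong)
  also have "\<dots> = (\<integral>\<^sup>+ v. c * indicator {v \<in> space (Pi\<^sub>M I M). E v} v \<partial>Pi\<^sub>M I M)"
    by (intro nn_integral_cong) simp
  finally show ?thesis by (simp add: nn_integral_cmult_indicator)
qed

lemma nn_integral_event_indep:
  assumes subset: "J \<subseteq> I" and h_measurable: "h \<in> borel_measurable (Pi\<^sub>M I M)"
    and event: "Measurable.pred (Pi\<^sub>M I M) E" "ignores_coords J (space (Pi\<^sub>M I M)) E"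
    and local: "ignores_coords (- J) UNIV h"
  shows "(\<integral>\<^sup>+ v. of_bool (E v) * h v \<partial>Pi\<^sub>M I M)
    = (\<integral>\<^sup>+ v. h v \<partial>Pi\<^sub>M I M) * emeasure (Pi\<^sub>M I M) {v \<in> space (Pi\<^sub>M I M). E v}"
proof (rule nn_integral_event_const_fibre[OF subset h_measurable event])
  interpret K: prob_space "Pi\<^sub>M (I - J) M" by (intro prob_space_PiM prob_space)
  have fibre: "h (merge (I - J) J (x, y)) = h y" for x y
    by (rule ignores_coordsD[OF local]) (simp_all add: merge_def)
  show "(\<integral>\<^sup>+ y. h (merge (I - J) J (x, y)) \<partial>Pi\<^sub>M J M) = (\<integral>\<^sup>+ v. h v \<partial>Pi\<^sub>M I M)" for x
    by (simp add: nn_integral_PiM_split[OF subset h_measurable] fibre K.emeasure_space_1)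
qed

end

lemma (in prob_space) has_bochner_integral_event_compensated:
  fixes f :: "'a \<Rightarrow> real"
  assumes [measurable]: "f \<in> borel_measurable M" "Measurable.pred M E"
    and nonneg: "\<And>x. x \<in> space M \<Longrightarrow> 0 \<le> f x" "0 \<le> c"
    and mean: "(\<integral>\<^sup>+ x. of_bool (E x) * ennreal (f x) \<partial>M)
      = ennreal c * emeasure M {x \<in> space M. E x}"
  shows "has_bochner_integral M (\<lambda>x. of_bool (E x) * (c - f x)) 0"
proof -
  let ?A = "{x \<in> space M. E x}"
  have "(\<integral>\<^sup>+ x. ennreal (of_bool (E x) * f x) \<partial>M) = (\<integral>\<^sup>+ x. of_bool (E x) * ennreal (f x) \<partial>M)"
    by (intro nn_integral_cong) auto
  also have "\<dots> = ennreal (c * prob ?A)"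
    using mean nonneg(2) by (simp add: emeasure_eq_measure ennreal_mult)
  finally have "has_bochner_integral M (\<lambda>x. of_bool (E x) * f x) (c * prob ?A)"
    using nonneg by (intro has_bochner_integral_nn_integral) auto
  moreover have "has_bochner_integral M (\<lambda>x. c * indicator ?A x) (c * prob ?A)"
    by (intro has_bochner_integral_mult_right has_bochner_integral_real_indicator)
      (auto simp: less_top[symmetric])
  ultimately have "has_bochner_integral M (\<lambda>x. c * indicator ?A x - of_bool (E x) * f x)
      (c * prob ?A - c * prob ?A)"
    by (rule has_bochner_integral_diff[rotated])
  then show ?thesis
    by (rule has_bochner_integral_cong[THEN iffD1, rotated 3]) (auto simp: right_diff_distrib)
qed

section \<open>Greedy matchings\<close>

lemma card_disjoint_family_meeting_le:
  assumes "disjoint_family_on e T" "finite A"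
  shows "card {t \<in> T. e t \<inter> A \<noteq> {}} \<le> card A"
proof -
  have "\<forall>t \<in> {t \<in> T. e t \<inter> A \<noteq> {}}. \<exists>a. a \<in> e t \<inter> A" by blast
  then obtain f where choice: "\<And>t. t \<in> {t \<in> T. e t \<inter> A \<noteq> {}} \<Longrightarrow> f t \<in> e t \<inter> A" by metis
  have "inj_on f {t \<in> T. e t \<inter> A \<noteq> {}}"
  proof (rule inj_onI, rule ccontr)
    fix s t assume "s \<in> {t \<in> T. e t \<inter> A \<noteq> {}}" "t \<in> {t \<in> T. e t \<inter> A \<noteq> {}}" "f s = f t" "s \<noteq> t"
    then show False using choice[of s] choice[of t] assms(1)
      by (fastforce simp: disjoint_family_on_def)
  qed
  then show ?thesis
    using choice \<open>finite A\<close> by (intro card_inj_on_le[of f]) auto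
qed

lemma disjoint_family_weight_le_dominating:
  fixes w :: "'b \<Rightarrow> real"
  assumes fin: "finite T" "finite G" and disj: "disjoint_family_on e T"
    and nonneg: "\<And>g. g \<in> G \<Longrightarrow> 0 \<le> w g" and size: "\<And>g. g \<in> G \<Longrightarrow> finite (e g) \<and> card (e g) \<le> k"
    and dom: "\<And>t. t \<in> T \<Longrightarrow> 0 \<le> w t \<Longrightarrow> \<exists>g \<in> G. e t \<inter> e g \<noteq> {} \<and> w t \<le> w g"
  shows "sum w T \<le> real k * sum w G"
proof -
  let ?meets = "\<lambda>t g. e t \<inter> e g \<noteq> {}"
  have "w t \<le> (\<Sum>g \<in> G. of_bool (?meets t g) * w g)" if member: "t \<in> T" for t
  proof (cases "0 \<le> w t")
    case True
    with dom member obtain g where dominating: "g \<in> G" "?meets t g" "w t \<le> w g" by blast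
    then have "w t \<le> of_bool (?meets t g) * w g" by simp
    also have "\<dots> \<le> (\<Sum>g \<in> G. of_bool (?meets t g) * w g)"
      using dominating fin nonneg by (intro member_le_sum) auto
    finally show ?thesis .
  next
    case False
    then show ?thesis using sum_nonneg[of G "\<lambda>g. of_bool (?meets t g) * w g"] nonneg by fastforce
  qed
  then have "sum w T \<le> (\<Sum>t \<in> T. \<Sum>g \<in> G. of_bool (?meets t g) * w g)" by (rule sum_mono)
  also have "\<dots> = (\<Sum>g \<in> G. real (card {t \<in> T. ?meets t g}) * w g)"
    using fin by (subst sum.swap)
      (simp add: sum_distrib_right[symmetric] Int_def del: sum_mult_of_bool_eq sum_of_bool_mult_eq)
  also have "\<dots> \<le> (\<Sum>g \<in> G. real k * w g)"
    using card_disjoint_family_meeting_le[OF disj] size nonneg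
    by (intro sum_mono mult_right_mono) (auto intro: order_trans)
  finally show ?thesis by (simp add: sum_distrib_left)
qed

section \<open>Adaptive exploration\<close>

text \<open>
  Arbitrary algorithms, for a fixed seed, and the descending procedures are both instances.
\<close>

locale exploration =
  fixes V :: "('b \<Rightarrow> real) measure" and X :: "'x set" and x0 :: 'x
    and continue :: "('b \<Rightarrow> real) \<Rightarrow> 'x \<Rightarrow> bool" and step :: "('b \<Rightarrow> real) \<Rightarrow> 'x \<Rightarrow> 'x"
    and rank :: "'x \<Rightarrow> nat" and opn :: "'x \<Rightarrow> 'b set"
  assumes countable_states: "countable X" and init_in: "x0 \<in> X" and opn_init: "opn x0 = {}"
    and step_in: "\<And>v x. v \<in> space V \<Longrightarrow> x \<in> X \<Longrightarrow> continue v x \<Longrightarrow> step v x \<in> X"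
    and step_rank: "\<And>v x. v \<in> space V \<Longrightarrow> x \<in> X \<Longrightarrow> continue v x \<Longrightarrow> rank (step v x) < rank x"
    and step_opens: "\<And>v x. opn (step v x) = opn x \<or> (\<exists>b. opn (step v x) = insert b (opn x))"
    and continue_cong: "\<And>v v' x. (\<And>b. b \<in> opn x \<Longrightarrow> v b = v' b) \<Longrightarrow> continue v x = continue v' x"
    and step_cong: "\<And>v v' x. (\<And>b. b \<in> opn x \<Longrightarrow> v b = v' b) \<Longrightarrow> step v x = step v' x"
    and advance_measurable:
      "\<And>x. x \<in> X \<Longrightarrow> (\<lambda>v. if continue v x then step v x else x) \<in> V \<rightarrow>\<^sub>M count_space UNIV"
begin

definition advance :: "('b \<Rightarrow> real) \<Rightarrow> 'x \<Rightarrow> 'x" where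
  "advance v x = (if continue v x then step v x else x)"

definition trajectory :: "nat \<Rightarrow> ('b \<Rightarrow> real) \<Rightarrow> 'x" where
  "trajectory n v = (advance v ^^ n) x0"

definition final :: "('b \<Rightarrow> real) \<Rightarrow> 'x" where
  "final v = while (continue v) (step v) x0"

lemma trajectory_0 [simp]: "trajectory 0 v = x0"
  and trajectory_Suc: "trajectory (Suc n) v = advance v (trajectory n v)"
  by (simp_all add: trajectory_def)

lemma trajectory_in: "v \<in> space V \<Longrightarrow> trajectory n v \<in> X"
  by (induction n) (simp_all add: init_in step_in trajectory_Suc advance_def)

lemma trajectory_measurable [measurable]: "trajectory n \<in> V \<rightarrow>\<^sub>M count_space X"
proof (induction n)
  case 0
  then show ?case using init_in by (simp add: trajectory_def[abs_def])
next
  case (Suc n)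
  have "(\<lambda>v. advance v x) \<in> V \<rightarrow>\<^sub>M count_space X" if "x \<in> X" for x
    using that step_in unfolding advance_def
    by (intro measurable_count_space_extend[OF subset_UNIV _ advance_measurable]) auto
  from measurable_compose_countable'[OF this Suc countable_states]
  show ?case by (simp add: trajectory_Suc[abs_def])
qed

lemma final_eq_trajectory: "v \<in> space V \<Longrightarrow> rank x0 \<le> n \<Longrightarrow> final v = trajectory n v"
  unfolding final_def trajectory_def advance_def[abs_def]
  using init_in step_in step_rank
  by (intro while_eq_funpow[where I = "\<lambda>x. x \<in> X" and rank = rank]) auto

lemma final_measurable: "final \<in> V \<rightarrow>\<^sub>M count_space X"
  by (rule measurable_cong[THEN iffD2, OF final_eq_trajectory[OF _ order_refl]
      trajectory_measurable])

lemma not_continue_final: "v \<in> space V \<Longrightarrow> \<not> continue v (final v)"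
  using trajectory_Suc[of "rank x0" v] final_eq_trajectory[of v "rank x0"]
    final_eq_trajectory[of v "Suc (rank x0)"] step_rank[of v "final v"]
    trajectory_in[of v "rank x0"]
  by (auto simp: advance_def)

lemma opn_advance: "opn (advance v x) = opn x \<or> (\<exists>b. opn (advance v x) = insert b (opn x))"
  using step_opens by (simp add: advance_def)

lemma opn_mono:
  assumes "m \<le> n"
  shows "opn (trajectory m v) \<subseteq> opn (trajectory n v)"
proof (rule lift_Suc_mono_le[where f = "\<lambda>n. opn (trajectory n v)", OF _ assms])
  show "opn (trajectory k v) \<subseteq> opn (trajectory (Suc k) v)" for k
    using opn_advance[of v "trajectory k v"] by (auto simp: trajectory_Suc)
qed

lemma opn_trajectory_le_final: "v \<in> space V \<Longrightarrow> opn (trajectory n v) \<subseteq> opn (final v)"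
  using opn_mono[of n "max n (rank x0)" v] final_eq_trajectory[of v "max n (rank x0)"] by simp

lemma trajectory_cong:
  assumes agree: "\<And>b. b \<notin> B \<Longrightarrow> v b = v' b" and "opn (trajectory n v) \<inter> B = {}"
  shows "trajectory n v = trajectory n v' \<and> trajectory (Suc n) v = trajectory (Suc n) v'"
proof -
  have advance_eq: "advance v x = advance v' x" if "opn x \<inter> B = {}" for x
    using continue_cong[of x v v'] step_cong[of x v v'] agree that by (auto simp: advance_def)
  from assms(2) have "trajectory n v = trajectory n v'"
  proof (induction n)
    case (Suc n)
    then have "opn (trajectory n v) \<inter> B = {}" using opn_mono[of n "Suc n" v] by auto
    with Suc.IH show ?case by (simp add: trajectory_Suc advance_eq[symmetric])
  qed simp
  with assms(2) show ?thesis by (simp add: trajectory_Suc advance_eq[symmetric])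
qed

definition opened :: "'b \<Rightarrow> ('b \<Rightarrow> real) \<Rightarrow> bool" where
  "opened b v \<longleftrightarrow> b \<in> opn (final v)"

definition opened_before :: "'b set \<Rightarrow> 'b \<Rightarrow> ('b \<Rightarrow> real) \<Rightarrow> bool" where
  "opened_before B b v \<longleftrightarrow> (\<exists>n. opn (trajectory n v) \<inter> B = {} \<and> b \<in> opn (trajectory (Suc n) v))"

lemma opened_before_imp_opened: "v \<in> space V \<Longrightarrow> opened_before B b v \<Longrightarrow> opened b v"
  using opn_trajectory_le_final by (auto simp: opened_before_def opened_def)

lemma opened_before_exists:
  assumes "v \<in> space V" "b \<in> B" "opened b v"
  obtains a where "a \<in> B" "opened_before B a v"
proof -
  have "opn (trajectory 0 v) \<inter> B = {}" "opn (trajectory (rank x0) v) \<inter> B \<noteq> {}"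
    using assms final_eq_trajectory[of v "rank x0"] opn_init by (auto simp: opened_def)
  then obtain n where "opn (trajectory n v) \<inter> B = {}" "opn (trajectory (Suc n) v) \<inter> B \<noteq> {}"
    using nat_induct[of "\<lambda>n. opn (trajectory n v) \<inter> B = {}" "rank x0"] by blast
  then show ?thesis using that by (auto simp: opened_before_def)
qed

lemma opened_before_unique:
  assumes "opened_before B a v" "opened_before B b v" "a \<in> B" "b \<in> B"
  shows "a = b"
proof -
  from assms obtain m n where
    time_a: "opn (trajectory m v) \<inter> B = {}" "a \<in> opn (trajectory (Suc m) v)" and
    time_b: "opn (trajectory n v) \<inter> B = {}" "b \<in> opn (trajectory (Suc n) v)"
    by (auto simp: opened_before_def)
  have "\<not> Suc m \<le> n" "\<not> Suc n \<le> m"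
    using opn_mono[of "Suc m" n v] opn_mono[of "Suc n" m v] time_a time_b assms(3,4) by auto
  then have "m = n" by simp
  then show ?thesis
    using opn_advance[of v "trajectory n v"] time_a time_b assms(3,4) by (auto simp: trajectory_Suc)
qed

lemma opened_before_ignores_coords: "ignores_coords B \<Omega> (opened_before B a)"
proof (rule ignores_coordsI)
  fix v v' :: "'b \<Rightarrow> real" assume agree: "\<And>b. b \<notin> B \<Longrightarrow> v b = v' b"
  show "opened_before B a v = opened_before B a v'"
    using trajectory_cong[of B v v'] trajectory_cong[of B v' v] agree
    unfolding opened_before_def by metis
qed

lemma opened_ignores_coords: "ignores_coords {b} (space V) (opened b)"
proof (rule ignores_coordsI)
  fix v v' assume in_space: "v \<in> space V" "v' \<in> space V" and agree: "\<And>a. a \<notin> {b} \<Longrightarrow> v a = v' a"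
  have "opened b w \<longleftrightarrow> opened_before {b} b w" if "w \<in> space V" for w
    using opened_before_imp_opened[OF that] opened_before_exists[OF that, of b "{b}"] by blast
  moreover have "opened_before {b} b v = opened_before {b} b v'"
    by (rule ignores_coordsD[OF opened_before_ignores_coords UNIV_I UNIV_I agree])
  ultimately show "opened b v = opened b v'" using in_space by simp
qed

lemma opened_measurable [measurable]: "Measurable.pred V (opened b)"
  unfolding opened_def by (rule measurable_compose[OF final_measurable]) simp

lemma opened_before_measurable [measurable]: "Measurable.pred V (opened_before B b)"
proof -
  have "Measurable.pred V (\<lambda>v. Q (trajectory n v))" for Q n
    by (rule measurable_compose[OF trajectory_measurable]) simp
  then show ?thesis
    unfolding opened_before_def[abs_def] by (intro pred_intros_countable pred_intros_logic)
qed

end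

section \<open>Capped indices and amortized costs\<close>

definition capped :: "ereal \<Rightarrow> real \<Rightarrow> real" where
  "capped t a = real_of_ereal (min t (ereal a))"

lemma ereal_capped: "t \<noteq> -\<infinity> \<Longrightarrow> ereal (capped t a) = min t (ereal a)"
  unfolding capped_def by (cases t) (auto simp: min_def)

lemma capped_le: "t \<noteq> -\<infinity> \<Longrightarrow> capped t a \<le> a"
  using ereal_capped[of t a] by (metis ereal_less_eq(3) min.cobounded2)

lemma excess_eq_minus_capped:
  "t \<noteq> -\<infinity> \<Longrightarrow> e2ennreal (max 0 (ereal a - t)) = ennreal (a - capped t a)"
  unfolding capped_def
  by (cases t) (auto simp: min_def max_def ereal_minus(1) simp flip: e2ennreal_ereal zero_ereal_def)

lemma capped_measurable [measurable]:
  assumes [measurable]: "f \<in> borel_measurable M" "g \<in> borel_measurable M"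
  shows "(\<lambda>x. capped (f x) (g x)) \<in> borel_measurable M"
  unfolding capped_def by measurable

type_synonym 'v realization = "'v \<times> 'v \<Rightarrow> real"

abbreviation edge :: "'v \<times> 'v \<Rightarrow> 'v set" where
  "edge b \<equiv> {fst b, snd b}"

lemma edge_swap: "edge (prod.swap b) = edge b"
  by auto

lemma boxes_iff: "b \<in> boxes P \<longleftrightarrow> edge b \<in> edges P"
  by (cases b) (simp add: boxes_def)

lemma swap_in_boxes [simp]: "prod.swap b \<in> boxes P \<longleftrightarrow> b \<in> boxes P"
  unfolding boxes_iff edge_swap ..

locale pandora_indices =
  fixes P :: "'v pandora" and \<sigma>1 :: "'v \<times> 'v \<Rightarrow> ereal" and \<sigma>2 :: "'v \<times> 'v \<Rightarrow> real \<Rightarrow> ereal"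
  assumes instance_P: "pandora_instance P" and indices: "are_indices P \<sigma>1 \<sigma>2"
begin

abbreviation "Box \<equiv> boxes P"

text \<open>
  The product measure locales need a probability measure at every index, while the instance
  constrains \<open>dist_of\<close> on the boxes only.
\<close>

definition law :: "'v \<times> 'v \<Rightarrow> real measure" where
  "law b = (if b \<in> Box then dist_of P b else return borel 0)"

abbreviation "joint_law \<equiv> Pi\<^sub>M Box law"

lemma finite_edges: "finite (edges P)"
  using instance_P
  by (intro finite_subset[of "edges P" "Pow (verts P)"]) (auto simp: pandora_instance_def)

lemma finite_boxes: "finite Box"
  using instance_P
  by (intro finite_subset[of Box "verts P \<times> verts P"])
    (fastforce simp: boxes_def pandora_instance_def)+

lemma card_edge: "b \<in> Box \<Longrightarrow> card (edge b) = 2"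
  using instance_P by (simp add: boxes_iff pandora_instance_def)

lemma swap_neq: "b \<in> Box \<Longrightarrow> prod.swap b \<noteq> b"
  using card_edge[of b] by (cases b) auto

definition openings :: "('v \<times> 'v) list set" where
  "openings = {bs. set bs \<subseteq> Box \<and> distinct bs}"

lemma finite_openings: "finite openings"
  unfolding openings_def by (intro finite_subset_distinct finite_boxes)

lemma length_openings: "bs \<in> openings \<Longrightarrow> length bs \<le> card Box"
  using card_mono[OF finite_boxes, of "set bs"] distinct_card[of bs] by (auto simp: openings_def)

lemma cost_nonneg: "b \<in> Box \<Longrightarrow> 0 \<le> cost P b"
  using instance_P by (simp add: pandora_instance_def)

lemma sets_law: "sets (law b) = sets borel"
  using instance_P by (simp add: law_def pandora_instance_def)

sublocale finite_product_prob_space law Box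
proof -
  have "prob_space (law b)" for b
    using instance_P by (auto simp: law_def pandora_instance_def intro: prob_space_return)
  then interpret product_prob_space law by (rule product_prob_spaceI)
  show "finite_product_prob_space law Box" by unfold_locales (rule finite_boxes)
qed

lemma value_measure_eq: "value_measure P = joint_law"
  unfolding value_measure_def by (rule PiM_cong) (auto simp: law_def)

lemma value_measurable [measurable]: "b \<in> Box \<Longrightarrow> (\<lambda>v. v b) \<in> borel_measurable joint_law"
  using measurable_component_singleton[of b Box law]
  by (simp cong: measurable_cong_sets add: sets_law)

lemma value_integrable:
  assumes box: "b \<in> Box"
  shows "integrable joint_law (\<lambda>v. v b)"
proof -
  have "integrable (distr joint_law (law b) (\<lambda>v. v b)) (\<lambda>x. x)"
    using box instance_P by (subst PiM_component) (simp_all add: law_def pandora_instance_def)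
  then show ?thesis
    using box
    by (subst (asm) integrable_distr_eq) (auto simp: measurable_cong_sets[OF sets_law refl])
qed

text \<open>Unlike \<^const>\<open>kappa2\<close>, these are real-valued, since the indices are never \<open>-\<infinity>\<close>.\<close>

definition \<kappa>3 :: "'v \<times> 'v \<Rightarrow> 'v realization \<Rightarrow> real" where
  "\<kappa>3 b v = v b + v (prod.swap b)"

definition \<kappa>2 :: "'v \<times> 'v \<Rightarrow> 'v realization \<Rightarrow> real" where
  "\<kappa>2 b v = capped (\<sigma>2 b (v b)) (\<kappa>3 b v)"

definition \<kappa>1 :: "'v \<times> 'v \<Rightarrow> 'v realization \<Rightarrow> real" where
  "\<kappa>1 b v = capped (\<sigma>1 b) (\<kappa>2 b v)"

lemma \<sigma>2_measurable [measurable]: "b \<in> Box \<Longrightarrow> \<sigma>2 b \<in> borel_measurable borel"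
  using indices by (auto simp: are_indices_def)

lemma \<sigma>2_equation:
  assumes "b \<in> Box"
  shows "(\<integral>\<^sup>+ y. e2ennreal (max 0 (ereal (x + y) - \<sigma>2 b x)) \<partial>law (prod.swap b))
    = ennreal (cost P (prod.swap b))"
  using indices assms swap_in_boxes[of b]
  by (cases b) (fastforce simp: are_indices_def kappa3_def law_def simp del: swap_in_boxes)

lemma \<sigma>2_not_MInf:
  assumes "b \<in> Box"
  shows "\<sigma>2 b x \<noteq> -\<infinity>"
proof
  assume "\<sigma>2 b x = -\<infinity>"
  with \<sigma>2_equation[OF assms, of x] show False
    by (simp add: max_def e2ennreal_infty M.emeasure_space_1 top_neq_ennreal)
qed

lemma ereal_\<kappa>2: "b \<in> Box \<Longrightarrow> ereal (\<kappa>2 b v) = min (\<sigma>2 b (v b)) (ereal (\<kappa>3 b v))"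
  unfolding \<kappa>2_def by (rule ereal_capped[OF \<sigma>2_not_MInf])

lemma \<sigma>1_equation:
  assumes "b \<in> Box"
  shows "(\<integral>\<^sup>+ v. e2ennreal (max 0 (ereal (\<kappa>2 b v) - \<sigma>1 b)) \<partial>joint_law) = ennreal (cost P b)"
  using indices assms
  by (cases b)
    (fastforce simp: are_indices_def ereal_\<kappa>2 kappa2_def kappa3_def \<kappa>3_def value_measure_eq)

lemma \<sigma>1_not_MInf:
  assumes "b \<in> Box"
  shows "\<sigma>1 b \<noteq> -\<infinity>"
proof
  assume "\<sigma>1 b = -\<infinity>"
  with \<sigma>1_equation[OF assms] show False
    by (simp add: max_def e2ennreal_infty P.emeasure_space_1 top_neq_ennreal)
qed

lemma ereal_\<kappa>1: "b \<in> Box \<Longrightarrow> ereal (\<kappa>1 b v) = min (\<sigma>1 b) (ereal (\<kappa>2 b v))"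
  unfolding \<kappa>1_def by (rule ereal_capped[OF \<sigma>1_not_MInf])

lemma \<kappa>2_le_\<kappa>3: "b \<in> Box \<Longrightarrow> \<kappa>2 b v \<le> \<kappa>3 b v"
  unfolding \<kappa>2_def by (rule capped_le[OF \<sigma>2_not_MInf])

lemma \<kappa>1_le_\<kappa>2: "b \<in> Box \<Longrightarrow> \<kappa>1 b v \<le> \<kappa>2 b v"
  unfolding \<kappa>1_def by (rule capped_le[OF \<sigma>1_not_MInf])

lemma \<kappa>3_measurable [measurable]: "b \<in> Box \<Longrightarrow> \<kappa>3 b \<in> borel_measurable joint_law"
  unfolding \<kappa>3_def[abs_def] by (intro borel_measurable_add value_measurable) simp_all

lemma \<kappa>2_measurable [measurable]: "b \<in> Box \<Longrightarrow> \<kappa>2 b \<in> borel_measurable joint_law"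
  unfolding \<kappa>2_def[abs_def]
  by (intro capped_measurable \<kappa>3_measurable measurable_compose[OF value_measurable \<sigma>2_measurable])

lemma \<kappa>1_measurable [measurable]: "b \<in> Box \<Longrightarrow> \<kappa>1 b \<in> borel_measurable joint_law"
  unfolding \<kappa>1_def[abs_def] by (intro capped_measurable \<kappa>2_measurable) simp_all

lemma first_cost_compensated:
  assumes box: "b \<in> Box" and event: "Measurable.pred joint_law E"
    "ignores_coords {b, prod.swap b} (space joint_law) E"
  shows "has_bochner_integral joint_law (\<lambda>v. of_bool (E v) * (cost P b - (\<kappa>2 b v - \<kappa>1 b v))) 0"
proof (rule has_bochner_integral_event_compensated)
  have "(\<integral>\<^sup>+ v. of_bool (E v) * ennreal (\<kappa>2 b v - \<kappa>1 b v) \<partial>joint_law)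
      = (\<integral>\<^sup>+ v. ennreal (\<kappa>2 b v - \<kappa>1 b v) \<partial>joint_law)
        * emeasure joint_law {v \<in> space joint_law. E v}"
  proof (rule nn_integral_event_indep[OF _ _ event])
    show "{b, prod.swap b} \<subseteq> Box" using box by simp
    show "ignores_coords (- {b, prod.swap b}) UNIV (\<lambda>v. ennreal (\<kappa>2 b v - \<kappa>1 b v))"
      by (rule ignores_coordsI) (simp add: \<kappa>1_def \<kappa>2_def \<kappa>3_def)
    show "(\<lambda>v. ennreal (\<kappa>2 b v - \<kappa>1 b v)) \<in> borel_measurable joint_law"
      using box
      by (intro measurable_compose[OF _ measurable_ennreal] borel_measurable_diff) simp_all
  qed
  also have "(\<integral>\<^sup>+ v. ennreal (\<kappa>2 b v - \<kappa>1 b v) \<partial>joint_law) = ennreal (cost P b)"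
    using \<sigma>1_equation[OF box] excess_eq_minus_capped[OF \<sigma>1_not_MInf[OF box]] by (simp add: \<kappa>1_def)
  finally show "(\<integral>\<^sup>+ v. of_bool (E v) * ennreal (\<kappa>2 b v - \<kappa>1 b v) \<partial>joint_law)
      = ennreal (cost P b) * emeasure joint_law {v \<in> space joint_law. E v}" .
qed (use box event \<kappa>1_le_\<kappa>2 cost_nonneg in auto)

lemma second_cost_compensated:
  assumes box: "b \<in> Box" and event: "Measurable.pred joint_law E"
    "ignores_coords {prod.swap b} (space joint_law) E"
  shows "has_bochner_integral joint_law
    (\<lambda>v. of_bool (E v) * (cost P (prod.swap b) - (\<kappa>3 b v - \<kappa>2 b v))) 0"
proof (rule has_bochner_integral_event_compensated)
  let ?J = "{prod.swap b}"
  show "(\<integral>\<^sup>+ v. of_bool (E v) * ennreal (\<kappa>3 b v - \<kappa>2 b v) \<partial>joint_law)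
      = ennreal (cost P (prod.swap b)) * emeasure joint_law {v \<in> space joint_law. E v}"
  proof (rule nn_integral_event_const_fibre[OF _ _ event])
    fix x :: "'v realization"
    let ?m = "\<lambda>y. merge (Box - ?J) ?J (x, y)"
    let ?excess = "\<lambda>y. e2ennreal (max 0 (ereal (x b + y) - \<sigma>2 b (x b)))"
    have "ennreal (\<kappa>3 b (?m y) - \<kappa>2 b (?m y)) = ?excess (y (prod.swap b))" for y
      using box swap_neq[OF box] excess_eq_minus_capped[OF \<sigma>2_not_MInf[OF box]]
      by (simp add: \<kappa>2_def \<kappa>3_def merge_def)
    then have "(\<integral>\<^sup>+ y. ennreal (\<kappa>3 b (?m y) - \<kappa>2 b (?m y)) \<partial>Pi\<^sub>M ?J law)
        = (\<integral>\<^sup>+ y. ?excess y \<partial>law (prod.swap b))"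
      using product_nn_integral_singleton[of ?excess "prod.swap b"]
      by (simp add: measurable_cong_sets[OF sets_law refl])
    then show "(\<integral>\<^sup>+ y. ennreal (\<kappa>3 b (?m y) - \<kappa>2 b (?m y)) \<partial>Pi\<^sub>M ?J law)
        = ennreal (cost P (prod.swap b))"
      by (simp add: \<sigma>2_equation[OF box])
  next
    show "?J \<subseteq> Box" using box by simp
    show "(\<lambda>v. ennreal (\<kappa>3 b v - \<kappa>2 b v)) \<in> borel_measurable joint_law"
      using box
      by (intro measurable_compose[OF _ measurable_ennreal] borel_measurable_diff) simp_all
  qed
qed (use box event \<kappa>2_le_\<kappa>3 cost_nonneg in auto)

definition bounds_matching_weight :: "('v realization \<Rightarrow> real) \<Rightarrow> bool" where
  "bounds_matching_weight G \<longleftrightarrow> (\<forall>v \<in> space joint_law. \<forall>T \<subseteq> Box.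
     disjoint_family_on edge T \<longrightarrow> (\<Sum>b \<in> T. \<kappa>1 b v) \<le> G v)"

lemma bounds_matching_weightD:
  "bounds_matching_weight G \<Longrightarrow> v \<in> space joint_law \<Longrightarrow> T \<subseteq> Box \<Longrightarrow> disjoint_family_on edge T \<Longrightarrow>
    (\<Sum>b \<in> T. \<kappa>1 b v) \<le> G v"
  unfolding bounds_matching_weight_def by blast

lemma bounds_matching_weight_integral_nonneg:
  assumes "bounds_matching_weight G"
  shows "0 \<le> (\<integral>v. G v \<partial>joint_law)"
proof (intro integral_nonneg_AE AE_I2)
  show "0 \<le> G v" if "v \<in> space joint_law" for v
    using bounds_matching_weightD[OF assms that, of "{}"] by (simp add: disjoint_family_on_def)
qed

lemma \<kappa>1_integrable:
  assumes box: "b \<in> Box"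
  shows "integrable joint_law (\<kappa>1 b)"
proof -
  have "integrable joint_law (\<lambda>v. cost P b - (\<kappa>2 b v - \<kappa>1 b v))"
    "integrable joint_law (\<lambda>v. cost P (prod.swap b) - (\<kappa>3 b v - \<kappa>2 b v))"
    using first_cost_compensated[OF box, of "\<lambda>_. True"]
      second_cost_compensated[OF box, of "\<lambda>_. True"]
    by (simp_all add: has_bochner_integral_iff ignores_coords_def)
  moreover have "integrable joint_law (\<lambda>v. \<kappa>3 b v - (cost P b + cost P (prod.swap b)))"
    unfolding \<kappa>3_def using box by (simp add: value_integrable)
  ultimately have "integrable joint_law (\<lambda>v. (cost P b - (\<kappa>2 b v - \<kappa>1 b v))
      + (cost P (prod.swap b) - (\<kappa>3 b v - \<kappa>2 b v)) + (\<kappa>3 b v - (cost P b + cost P (prod.swap b))))"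
    by (intro Bochner_Integration.integrable_add)
  then show ?thesis by simp
qed

end

locale pandora_exploration = pandora_indices P \<sigma>1 \<sigma>2 +
  exploration "Pi\<^sub>M (boxes P) (pandora_indices.law P)" X x0 continue step rank opn
  for P :: "'v pandora" and \<sigma>1 \<sigma>2 and X :: "'x set" and x0 continue step rank opn
begin

definition opened_first :: "'v \<times> 'v \<Rightarrow> 'v realization \<Rightarrow> bool" where
  "opened_first b = opened_before {b, prod.swap b} b"

definition completed :: "'v \<times> 'v \<Rightarrow> 'v realization \<Rightarrow> bool" where
  "completed b v \<longleftrightarrow> opened_first b v \<and> opened (prod.swap b) v"

lemma opened_first_imp_opened: "v \<in> space joint_law \<Longrightarrow> opened_first b v \<Longrightarrow> opened b v"
  unfolding opened_first_def by (rule opened_before_imp_opened)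

lemma opened_first_swap: "opened_first (prod.swap b) = opened_before {b, prod.swap b} (prod.swap b)"
  by (simp add: opened_first_def insert_commute)

lemma opened_first_total:
  assumes "v \<in> space joint_law" "opened b v"
  shows "opened_first b v \<or> opened_first (prod.swap b) v"
  using opened_before_exists[OF assms(1) _ assms(2), of "{b, prod.swap b}"]
  unfolding opened_first_swap unfolding opened_first_def by blast

lemma opened_first_exclusive: "b \<in> Box \<Longrightarrow> opened_first b v \<Longrightarrow> \<not> opened_first (prod.swap b) v"
  using opened_before_unique[of "{b, prod.swap b}" b v "prod.swap b"] swap_neq[of b]
  unfolding opened_first_swap unfolding opened_first_def by fastforce

definition amortization_gap :: "'v realization \<Rightarrow> real" where
  "amortization_gap v = (\<Sum>b \<in> Box. of_bool (opened_first b v) * (cost P b - (\<kappa>2 b v - \<kappa>1 b v))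
     + of_bool (completed b v) * (cost P (prod.swap b) - (\<kappa>3 b v - \<kappa>2 b v)))"

lemma amortization_gap_mean_zero: "has_bochner_integral joint_law amortization_gap 0"
proof -
  have "has_bochner_integral joint_law
      (\<lambda>v. of_bool (opened_first b v) * (cost P b - (\<kappa>2 b v - \<kappa>1 b v))) 0" if "b \<in> Box" for b
    unfolding opened_first_def using that
    by (intro first_cost_compensated opened_before_measurable opened_before_ignores_coords)
  moreover have "has_bochner_integral joint_law
      (\<lambda>v. of_bool (completed b v) * (cost P (prod.swap b) - (\<kappa>3 b v - \<kappa>2 b v))) 0"
    if "b \<in> Box" for b
  proof (rule second_cost_compensated[OF that])
    show "Measurable.pred joint_law (completed b)"
      unfolding completed_def opened_first_def by measurable
    have "ignores_coords {prod.swap b} (space joint_law) (opened_first b)"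
      unfolding opened_first_def
      by (rule ignores_coords_mono[OF opened_before_ignores_coords]) simp
    then show "ignores_coords {prod.swap b} (space joint_law) (completed b)"
      unfolding completed_def by (intro ignores_coords_conj opened_ignores_coords)
  qed
  ultimately have "has_bochner_integral joint_law amortization_gap (\<Sum>b \<in> Box. 0 + 0)"
    unfolding amortization_gap_def[abs_def]
    by (intro has_bochner_integral_sum has_bochner_integral_add)
  then show ?thesis by simp
qed

definition amortized_payoff :: "'v set set \<Rightarrow> 'v realization \<Rightarrow> 'v \<times> 'v \<Rightarrow> real" where
  "amortized_payoff M v b =
     of_bool (opened_first b v) * (of_bool (edge b \<in> M) * \<kappa>3 b v - (\<kappa>2 b v - \<kappa>1 b v))
     - of_bool (completed b v) * (\<kappa>3 b v - \<kappa>2 b v)"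

lemma payoff_by_baskets:
  assumes in_space: "v \<in> space joint_law" and opened_boxes: "set bs = {b. opened b v}"
    and matched_opened: "\<And>b. edge b \<in> M \<Longrightarrow> opened b v"
  shows "payoff P v (bs, M) = (\<Sum>b \<in> Box.
    of_bool (opened_first b v) * (of_bool (edge b \<in> M) * \<kappa>3 b v - cost P b)
    - of_bool (completed b v) * cost P (prod.swap b))"
proof -
  let ?in = "\<lambda>b. of_bool (edge b \<in> M) :: real"
  let ?head = "\<lambda>b. of_bool (opened_first b v) * (?in b * v b - cost P b)"
  let ?tail = "\<lambda>b. of_bool (opened_first (prod.swap b) v)
    * (?in b * v b - of_bool (opened b v) * cost P b)"
  have "payoff P v (bs, M) = (\<Sum>b \<in> Box. ?in b * v b - of_bool (opened b v) * cost P b)"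
    by (simp add: payoff_def opened_boxes case_prod_beta)
  also have "\<dots> = (\<Sum>b \<in> Box. ?head b + ?tail b)"
  proof (rule sum.cong[OF refl])
    fix b assume "b \<in> Box"
    then show "?in b * v b - of_bool (opened b v) * cost P b = ?head b + ?tail b"
      using opened_first_total[OF in_space, of b] opened_first_imp_opened[OF in_space, of b]
        opened_first_exclusive[of b v] matched_opened[of b] by auto
  qed
  also have "\<dots> = (\<Sum>b \<in> Box. ?head b) + (\<Sum>b \<in> Box. ?tail (prod.swap b))"
    unfolding sum.distrib
    by (intro arg_cong2[of _ _ _ _ "(+)"] refl
        sum.reindex_bij_witness[of _ prod.swap prod.swap]) auto
  also have "\<dots> = (\<Sum>b \<in> Box. of_bool (opened_first b v) * (?in b * \<kappa>3 b v - cost P b)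
    - of_bool (completed b v) * cost P (prod.swap b))"
    unfolding sum.distrib[symmetric]
    by (intro sum.cong) (auto simp: \<kappa>3_def completed_def insert_commute algebra_simps)
  finally show ?thesis .
qed

lemma payoff_add_amortization_gap:
  assumes "v \<in> space joint_law" "set bs = {b. opened b v}" "\<And>b. edge b \<in> M \<Longrightarrow> opened b v"
  shows "payoff P v (bs, M) + amortization_gap v = (\<Sum>b \<in> Box. amortized_payoff M v b)"
  using assms
  by (subst payoff_by_baskets)
    (auto simp: amortization_gap_def amortized_payoff_def algebra_simps simp flip: sum.distrib
      intro!: sum.cong)

lemma amortized_payoff_matched: "edge b \<in> M \<Longrightarrow> completed b v \<Longrightarrow> amortized_payoff M v b = \<kappa>1 b v"
  by (simp add: amortized_payoff_def completed_def)

lemma amortized_payoff_le: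
  assumes "b \<in> Box" and "edge b \<in> M \<Longrightarrow> opened (prod.swap b) v"
  shows "amortized_payoff M v b \<le> of_bool (edge b \<in> M \<and> opened_first b v) * \<kappa>1 b v"
  using assms \<kappa>1_le_\<kappa>2[of b v] \<kappa>2_le_\<kappa>3[of b v] by (auto simp: amortized_payoff_def completed_def)

lemma payoff_le_matching_weight:
  assumes in_space: "v \<in> space joint_law" and opened_boxes: "set bs = {b. opened b v}"
    and matching: "is_matching P M" "\<And>b. edge b \<in> M \<Longrightarrow> opened b v"
  obtains T where "T \<subseteq> Box" "disjoint_family_on edge T"
    "payoff P v (bs, M) + amortization_gap v \<le> (\<Sum>b \<in> T. \<kappa>1 b v)"
proof
  let ?T = "{b \<in> Box. edge b \<in> M \<and> opened_first b v}"
  show "?T \<subseteq> Box" by blast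
  show "disjoint_family_on edge ?T"
    unfolding disjoint_family_on_def
  proof (intro ballI impI)
    fix a b assume members: "a \<in> ?T" "b \<in> ?T" "a \<noteq> b"
    then have "edge a \<noteq> edge b"
      using opened_first_exclusive[of a v] by (cases a; cases b) (auto simp: doubleton_eq_iff)
    with members matching(1) show "edge a \<inter> edge b = {}"
      by (intro disjointD[of M]) (auto simp: is_matching_def)
  qed
  have "payoff P v (bs, M) + amortization_gap v = (\<Sum>b \<in> Box. amortized_payoff M v b)"
    by (rule payoff_add_amortization_gap[OF in_space opened_boxes matching(2)])
  also have "\<dots> \<le> (\<Sum>b \<in> Box. of_bool (edge b \<in> M \<and> opened_first b v) * \<kappa>1 b v)"
    using matching(2)[of "prod.swap b" for b]
    by (intro sum_mono amortized_payoff_le) (simp_all only: edge_swap)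
  also have "\<dots> = (\<Sum>b \<in> ?T. \<kappa>1 b v)"
    using finite_boxes by (simp add: Int_def)
  finally show "payoff P v (bs, M) + amortization_gap v \<le> (\<Sum>b \<in> ?T. \<kappa>1 b v)" .
qed

end

lemma observe_cong: "(\<And>b. b \<in> set bs \<Longrightarrow> v b = v' b) \<Longrightarrow> observe v bs = observe v' bs"
  by (simp add: observe_def)

section \<open>Arbitrary algorithms\<close>

locale policy = pandora_indices P \<sigma>1 \<sigma>2 for P :: "'v pandora" and \<sigma>1 \<sigma>2 +
  fixes \<pi> :: "'v history \<Rightarrow> 'v action"
  assumes legal: "\<And>bs v. distinct bs \<Longrightarrow> set bs \<subseteq> boxes P \<Longrightarrow> v \<in> space joint_law \<Longrightarrow>
      legal_action P bs (\<pi> (observe v bs))"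
    and \<pi>_measurable: "\<And>bs. distinct bs \<Longrightarrow> set bs \<subseteq> boxes P \<Longrightarrow>
      (\<lambda>v. \<pi> (observe v bs)) \<in> joint_law \<rightarrow>\<^sub>M count_space UNIV"
begin

definition opens_next :: "'v realization \<Rightarrow> ('v \<times> 'v) list \<Rightarrow> bool" where
  "opens_next v bs \<longleftrightarrow> is_Open (\<pi> (observe v bs))"

definition open_next :: "'v realization \<Rightarrow> ('v \<times> 'v) list \<Rightarrow> ('v \<times> 'v) list" where
  "open_next v bs = bs @ [next_box (\<pi> (observe v bs))]"

lemma open_next_in_openings:
  assumes "v \<in> space joint_law" "bs \<in> openings" "opens_next v bs"
  shows "open_next v bs \<in> openings"
  using legal[of bs v] assms
  by (cases "\<pi> (observe v bs)") (auto simp: opens_next_def open_next_def openings_def)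

sublocale pandora_exploration P \<sigma>1 \<sigma>2 openings "[]" opens_next open_next
  "\<lambda>bs. card Box - length bs" set
proof unfold_locales
  show "countable openings" by (rule countable_finite[OF finite_openings])
  show "card Box - length (open_next v bs) < card Box - length bs"
    if "v \<in> space joint_law" "bs \<in> openings" "opens_next v bs" for v bs
    using length_openings[OF open_next_in_openings[OF that]] by (simp add: open_next_def)
  show "opens_next v bs = opens_next v' bs" "open_next v bs = open_next v' bs"
    if "\<And>b. b \<in> set bs \<Longrightarrow> v b = v' b" for v v' bs
    using observe_cong[of bs v v'] that by (simp_all add: opens_next_def open_next_def)
  show "(\<lambda>v. if opens_next v bs then open_next v bs else bs) \<in> joint_law \<rightarrow>\<^sub>M count_space UNIV"
    if "bs \<in> openings" for bs
    unfolding opens_next_def open_next_def using that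
    by (intro measurable_compose[OF \<pi>_measurable,
          where g = "\<lambda>a. if is_Open a then bs @ [next_box a] else bs"])
      (simp_all add: openings_def)
  show "set (open_next v bs) = set bs \<or> (\<exists>b. set (open_next v bs) = insert b (set bs))" for v bs
    unfolding open_next_def by (intro disjI2 exI) simp
qed (simp_all add: open_next_in_openings, simp add: openings_def)

lemma run_algorithm_final:
  assumes in_space: "v \<in> space joint_law"
  obtains bs M where "run_algorithm \<pi> v = (bs, M)" "set bs = {b. opened b v}"
    "is_matching P M" "\<And>b. edge b \<in> M \<Longrightarrow> opened b v"
proof -
  have while_final: "while (\<lambda>bs. is_Open (\<pi> (observe v bs)))
      (\<lambda>bs. bs @ [next_box (\<pi> (observe v bs))]) [] = final v"
    unfolding final_def unfolding opens_next_def[abs_def] open_next_def[abs_def] ..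
  obtain M where stops: "\<pi> (observe v (final v)) = Stop M"
    using not_continue_final[OF in_space]
    by (cases "\<pi> (observe v (final v))") (auto simp: opens_next_def)
  have "final v \<in> openings"
    using trajectory_in[OF in_space] final_eq_trajectory[OF in_space order_refl] by simp
  then have legal_stop: "legal_action P (final v) (Stop M)"
    using legal[of "final v" v] in_space by (simp add: stops openings_def)
  show ?thesis
  proof (rule that)
    show "run_algorithm \<pi> v = (final v, M)"
      by (simp add: run_algorithm_def Let_def while_final stops)
    show "set (final v) = {b. opened b v}" by (simp add: opened_def)
    show "is_matching P M" using legal_stop by simp
    show "opened b v" if "edge b \<in> M" for b
      using legal_stop that by (cases b) (simp add: opened_def)
  qed
qed

lemma integral_payoff_le:
  assumes integrable: "integrable joint_law G" and bound: "bounds_matching_weight G"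
  shows "(\<integral>v. payoff P v (run_algorithm \<pi> v) \<partial>joint_law) \<le> (\<integral>v. G v \<partial>joint_law)"
proof (cases "integrable joint_law (\<lambda>v. payoff P v (run_algorithm \<pi> v))")
  case True
  have gap: "integrable joint_law amortization_gap" "(\<integral>v. amortization_gap v \<partial>joint_law) = 0"
    using amortization_gap_mean_zero by (simp_all add: has_bochner_integral_iff)
  have "(\<integral>v. payoff P v (run_algorithm \<pi> v) \<partial>joint_law)
      = (\<integral>v. payoff P v (run_algorithm \<pi> v) + amortization_gap v \<partial>joint_law)"
    using True gap by simp
  also have "\<dots> \<le> (\<integral>v. G v \<partial>joint_law)"
  proof (rule integral_mono)
    fix v assume in_space: "v \<in> space joint_law"
    obtain bs M where run: "run_algorithm \<pi> v = (bs, M)" "set bs = {b. opened b v}"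
        "is_matching P M" "\<And>b. edge b \<in> M \<Longrightarrow> opened b v"
      using run_algorithm_final[OF in_space] by blast
    obtain T where "T \<subseteq> Box" "disjoint_family_on edge T"
        "payoff P v (bs, M) + amortization_gap v \<le> (\<Sum>b \<in> T. \<kappa>1 b v)"
      by (rule payoff_le_matching_weight[OF in_space run(2-4)])
    then show "payoff P v (run_algorithm \<pi> v) + amortization_gap v \<le> G v"
      using bounds_matching_weightD[OF bound in_space, of T] by (simp add: run(1))
  qed (use True gap integrable in auto)
  finally show ?thesis .
next
  case False
  then show ?thesis
    using bounds_matching_weight_integral_nonneg[OF bound] by (simp add: not_integrable_integral_eq)
qed

end

lemma (in pandora_indices) welfare_le:
  fixes R :: "'s measure"
  assumes "prob_space R" and \<pi>: "is_algorithm P R \<pi>"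
    and integrable: "integrable joint_law G" and bound: "bounds_matching_weight G"
  shows "welfare P R \<pi> \<le> (\<integral>v. G v \<partial>joint_law)"
proof -
  interpret R: prob_space R by fact
  interpret RV: pair_prob_space R joint_law ..
  let ?f = "\<lambda>(s, v). payoff P v (run_algorithm (\<pi> s) v)"
  have policy: "policy P \<sigma>1 \<sigma>2 (\<pi> s)" if seed: "s \<in> space R" for s
  proof unfold_locales
    fix bs :: "('v \<times> 'v) list" assume boxes: "distinct bs" "set bs \<subseteq> Box"
    show "legal_action P bs (\<pi> s (observe v bs))" if "v \<in> space joint_law" for v
      using \<pi> seed boxes that unfolding is_algorithm_def value_measure_eq by blast
    have "(\<lambda>(s, v). \<pi> s (observe v bs)) \<in> R \<Otimes>\<^sub>M joint_law \<rightarrow>\<^sub>M count_space UNIV"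
      using \<pi> boxes unfolding is_algorithm_def value_measure_eq by blast
    from measurable_compose[OF measurable_Pair1'[OF seed] this]
    show "(\<lambda>v. \<pi> s (observe v bs)) \<in> joint_law \<rightarrow>\<^sub>M count_space UNIV" by simp
  qed
  show ?thesis
  proof (cases "integrable (R \<Otimes>\<^sub>M joint_law) ?f")
    case True
    have "welfare P R \<pi> = (\<integral>s. (\<integral>v. ?f (s, v) \<partial>joint_law) \<partial>R)"
      unfolding welfare_def value_measure_eq by (rule RV.integral_fst'[OF True, symmetric])
    also have "\<dots> \<le> (\<integral>s. (\<integral>v. G v \<partial>joint_law) \<partial>R)"
      by (rule integral_mono[OF RV.integrable_fst'[OF True]])
        (use policy.integral_payoff_le[OF policy integrable bound] in auto)
    finally show ?thesis by (simp add: R.prob_space)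
  next
    case False
    then show ?thesis
      using bounds_matching_weight_integral_nonneg[OF bound]
      unfolding welfare_def value_measure_eq by (simp add: not_integrable_integral_eq)
  qed
qed

section \<open>The descending procedure\<close>

context pandora_indices
begin

definition index :: "'v realization \<Rightarrow> ('v \<times> 'v) list \<Rightarrow> 'v \<times> 'v \<Rightarrow> ereal" where
  "index v bs b =
     (if b \<notin> set bs then \<sigma>1 b
      else if prod.swap b \<notin> set bs then \<sigma>2 b (v b)
      else ereal (\<kappa>3 b v))"

lemma current_index_observe: "current_index \<sigma>1 \<sigma>2 (observe v bs) = index v bs"
proof
  fix b :: "'v \<times> 'v"
  have "map_of (observe v bs) = (Some \<circ> v) |` set bs"
    unfolding observe_def by (rule map_of_map_restrict)
  then show "current_index \<sigma>1 \<sigma>2 (observe v bs) b = index v bs b"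
    by (cases b) (simp add: current_index_def index_def \<kappa>3_def kappa3_def restrict_map_def)
qed

lemma index_measurable: "b \<in> Box \<Longrightarrow> (\<lambda>v. index v bs b) \<in> borel_measurable joint_law"
  unfolding index_def
  by (auto intro!: measurable_compose[OF value_measurable \<sigma>2_measurable] measurable_If \<kappa>3_measurable
    borel_measurable_ereal)

text \<open>The indices at which the basket \<open>b\<close> stood when its boxes were opened.\<close>

definition past_indices :: "'v realization \<Rightarrow> ('v \<times> 'v) list \<Rightarrow> 'v \<times> 'v \<Rightarrow> ereal set" where
  "past_indices v bs b = {t. b \<in> set bs \<and> t = \<sigma>1 b \<or> prod.swap b \<in> set bs \<and> t = \<sigma>2 b (v b)}"

lemma \<kappa>1_le_index: "b \<in> Box \<Longrightarrow> ereal (\<kappa>1 b v) \<le> index v bs b"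
  by (simp add: index_def ereal_\<kappa>1 ereal_\<kappa>2 min_le_iff_disj)

lemma le_\<kappa>1_if_both_open:
  assumes "b \<in> Box" "{b, prod.swap b} \<subseteq> set bs"
    and "\<And>s. s \<in> past_indices v bs b \<Longrightarrow> t \<le> s" "t \<le> index v bs b"
  shows "t \<le> ereal (\<kappa>1 b v)"
  using assms by (simp add: index_def past_indices_def ereal_\<kappa>1 ereal_\<kappa>2)

lemma \<kappa>1_eq_\<kappa>2_if_index_le_past:
  assumes box: "b \<in> Box" "b \<in> set bs" and "\<And>t. t \<in> past_indices v bs b \<Longrightarrow> index v bs b \<le> t"
  shows "\<kappa>1 b v = \<kappa>2 b v"
proof -
  have "ereal (\<kappa>2 b v) \<le> index v bs b"
    using box by (simp add: index_def ereal_\<kappa>2)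
  also have "\<dots> \<le> \<sigma>1 b"
    using assms by (simp add: past_indices_def)
  finally have "ereal (\<kappa>1 b v) = ereal (\<kappa>2 b v)"
    using box by (simp add: ereal_\<kappa>1 min_absorb2)
  then show ?thesis by simp
qed

lemma \<kappa>2_eq_\<kappa>3_if_index_le_past:
  assumes box: "b \<in> Box" "{b, prod.swap b} \<subseteq> set bs"
    and "\<And>t. t \<in> past_indices v bs b \<Longrightarrow> index v bs b \<le> t"
  shows "\<kappa>2 b v = \<kappa>3 b v"
proof -
  have "ereal (\<kappa>3 b v) \<le> \<sigma>2 b (v b)"
    using assms by (simp add: index_def past_indices_def)
  then have "ereal (\<kappa>2 b v) = ereal (\<kappa>3 b v)"
    using box by (simp add: ereal_\<kappa>2 min_absorb2)
  then show ?thesis by simp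
qed

end

definition pending_box :: "('v \<times> 'v) list \<Rightarrow> 'v \<times> 'v \<Rightarrow> 'v \<times> 'v" where
  "pending_box bs b = (if b \<in> set bs then prod.swap b else b)"

lemma descending_step_eq:
  "descending_step sel v (bs, S, M) = (let b = sel (observe v bs) S in
     if {b, prod.swap b} \<subseteq> set bs then (bs, {d \<in> S. edge d \<inter> edge b = {}}, insert (edge b) M)
     else (bs @ [pending_box bs b], S, M))"
  by (cases "sel (observe v bs) S") (auto simp: descending_step_def pending_box_def)

lemma is_orientation_iff:
  "is_orientation P Ori \<longleftrightarrow> Ori \<subseteq> boxes P \<and> (\<forall>b \<in> boxes P. prod.swap b \<in> Ori \<longleftrightarrow> b \<notin> Ori)"
  unfolding is_orientation_def by auto

lemma mem_converse_iff_swap: "b \<in> r\<inverse> \<longleftrightarrow> prod.swap b \<in> r"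
  by (cases b) simp

lemma is_orientation_converse:
  assumes "is_orientation P Ori"
  shows "is_orientation P (Ori\<inverse>)"
  unfolding is_orientation_iff
proof (intro conjI subsetI ballI)
  show "b \<in> boxes P" if "b \<in> Ori\<inverse>" for b
    using that assms swap_in_boxes unfolding is_orientation_iff mem_converse_iff_swap by blast
  show "prod.swap b \<in> Ori\<inverse> \<longleftrightarrow> b \<notin> Ori\<inverse>" if "b \<in> boxes P" for b
    using that assms by (simp add: is_orientation_iff mem_converse_iff_swap)
qed

locale descending = pandora_indices P \<sigma>1 \<sigma>2 for P :: "'v pandora" and \<sigma>1 \<sigma>2 +
  fixes sel :: "'v history \<Rightarrow> ('v \<times> 'v) set \<Rightarrow> 'v \<times> 'v" and Ori :: "('v \<times> 'v) set"
  assumes selection: "is_selection P \<sigma>1 \<sigma>2 sel" and orientation: "is_orientation P Ori"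
begin

lemma Ori_boxes: "Ori \<subseteq> Box"
  using orientation by (simp add: is_orientation_def)

lemma finite_Ori: "finite Ori"
  by (rule finite_subset[OF Ori_boxes finite_boxes])

lemma swap_in_Ori_iff: "b \<in> Box \<Longrightarrow> prod.swap b \<in> Ori \<longleftrightarrow> b \<notin> Ori"
  using orientation by (simp add: is_orientation_iff)

lemma Ori_swap_neq: "b \<in> Ori \<Longrightarrow> d \<in> Ori \<Longrightarrow> prod.swap b \<noteq> d"
  using swap_in_Ori_iff Ori_boxes by blast

lemma edge_inj_on_Ori: "b \<in> Ori \<Longrightarrow> d \<in> Ori \<Longrightarrow> edge b = edge d \<Longrightarrow> b = d"
  using Ori_swap_neq[of b d] by (cases b; cases d) (auto simp: doubleton_eq_iff)

definition states :: "'v state set" where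
  "states = openings \<times> Pow Ori \<times> Pow (edges P)"

definition selected :: "'v realization \<Rightarrow> ('v \<times> 'v) list \<Rightarrow> ('v \<times> 'v) set \<Rightarrow> 'v \<times> 'v \<Rightarrow> bool" where
  "selected v bs S b \<longleftrightarrow> b \<in> S \<and> 0 \<le> index v bs b \<and> (\<forall>d \<in> S. index v bs d \<le> index v bs b)"

lemma descending_continues_iff:
  assumes "S \<subseteq> Ori"
  shows "descending_continues \<sigma>1 \<sigma>2 v (bs, S, M) \<longleftrightarrow> (\<exists>d \<in> S. 0 \<le> index v bs d)"
proof -
  have "finite S" by (rule finite_subset[OF assms finite_Ori])
  then show ?thesis
    by (cases "S = {}")
      (simp_all add: descending_continues_def current_index_observe not_less Max_ge_iff)
qed

lemma selected_sel:
  assumes subset: "S \<subseteq> Ori" and "descending_continues \<sigma>1 \<sigma>2 v (bs, S, M)"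
  shows "selected v bs S (sel (observe v bs) S)"
proof -
  obtain d where candidate: "d \<in> S" "0 \<le> index v bs d"
    using assms descending_continues_iff by blast
  then have "sel (observe v bs) S \<in> S" "\<forall>d \<in> S. index v bs d \<le> index v bs (sel (observe v bs) S)"
    using selection subset Ori_boxes
    unfolding is_selection_def current_index_observe[symmetric] by blast+
  with candidate show ?thesis
    unfolding selected_def by (blast intro: order_trans)
qed

lemma descending_step_cases [consumes 2, case_names open_box match]:
  assumes "(bs, S, M) \<in> states" "descending_continues \<sigma>1 \<sigma>2 v (bs, S, M)"
  obtains b where "selected v bs S b" "b \<in> Ori" "\<not> {b, prod.swap b} \<subseteq> set bs"
      "descending_step sel v (bs, S, M) = (bs @ [pending_box bs b], S, M)"
  | b where "selected v bs S b" "b \<in> Ori" "{b, prod.swap b} \<subseteq> set bs"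
      "descending_step sel v (bs, S, M) = (bs, {d \<in> S. edge d \<inter> edge b = {}}, insert (edge b) M)"
proof -
  have subset: "S \<subseteq> Ori" using assms(1) by (simp add: states_def)
  note selected = selected_sel[OF subset assms(2)]
  then have "sel (observe v bs) S \<in> Ori" using subset by (auto simp: selected_def)
  with selected that show ?thesis
    by (cases "{sel (observe v bs) S, prod.swap (sel (observe v bs) S)} \<subseteq> set bs")
      (auto simp: descending_step_eq Let_def)
qed

lemma descending_step_in_states:
  assumes "(bs, S, M) \<in> states" "descending_continues \<sigma>1 \<sigma>2 v (bs, S, M)"
  shows "descending_step sel v (bs, S, M) \<in> states"
  using assms
proof (cases rule: descending_step_cases)
  case (open_box b)
  then have "pending_box bs b \<in> Box - set bs"
    using Ori_boxes by (auto simp: pending_box_def)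
  with open_box(4) assms(1) show ?thesis by (simp add: states_def openings_def)
next
  case (match b)
  then have "edge b \<in> edges P" using Ori_boxes boxes_iff by blast
  with match(4) assms(1) show ?thesis by (auto simp: states_def)
qed

definition remaining :: "'v state \<Rightarrow> nat" where
  "remaining = (\<lambda>(bs, S, M). card Box - length bs + card S)"

lemma remaining_descending_step:
  assumes "(bs, S, M) \<in> states" "descending_continues \<sigma>1 \<sigma>2 v (bs, S, M)"
  shows "remaining (descending_step sel v (bs, S, M)) < remaining (bs, S, M)"
  using assms
proof (cases rule: descending_step_cases)
  case (open_box b)
  then have "bs @ [pending_box bs b] \<in> openings"
    using descending_step_in_states[OF assms] by (simp add: states_def)
  from length_openings[OF this] open_box(4) show ?thesis by (simp add: remaining_def)
next
  case (match b)
  then have "{d \<in> S. edge d \<inter> edge b = {}} \<subset> S" by (auto simp: selected_def)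
  moreover have "finite S" using assms(1) finite_subset[OF _ finite_Ori] by (auto simp: states_def)
  ultimately show ?thesis using match(4) psubset_card_mono by (simp add: remaining_def)
qed

lemma descending_advance_measurable:
  assumes state: "x \<in> states"
  shows "(\<lambda>v. if descending_continues \<sigma>1 \<sigma>2 v x then descending_step sel v x else x)
    \<in> joint_law \<rightarrow>\<^sub>M count_space UNIV"
proof -
  obtain bs S M where state_eq: "x = (bs, S, M)" by (cases x)
  have subset: "S \<subseteq> Ori" "finite S" and boxes: "distinct bs" "set bs \<subseteq> Box"
    using state finite_subset[OF _ finite_Ori] by (auto simp: states_def openings_def state_eq)
  show ?thesis
  proof (cases "S = {}")
    case True
    then show ?thesis by (simp add: state_eq descending_continues_def)
  next
    case False
    have "(\<lambda>v. sel (observe v bs) S) \<in> joint_law \<rightarrow>\<^sub>M count_space UNIV"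
      using selection False subset Ori_boxes boxes by (simp add: is_selection_def value_measure_eq)
    then have "(\<lambda>v. descending_step sel v (bs, S, M)) \<in> joint_law \<rightarrow>\<^sub>M count_space UNIV"
      unfolding descending_step_def prod.case by (rule measurable_compose) simp
    moreover have "Measurable.pred joint_law (\<lambda>v. descending_continues \<sigma>1 \<sigma>2 v (bs, S, M))"
      unfolding descending_continues_iff[OF subset(1)] not_less[symmetric] using subset Ori_boxes
      by (intro pred_intros_finite pred_intros_logic borel_measurable_pred_less index_measurable)
        auto
    ultimately show ?thesis
      unfolding state_eq by (intro measurable_If) auto
  qed
qed

sublocale pandora_exploration P \<sigma>1 \<sigma>2 states "([], Ori, {})" "descending_continues \<sigma>1 \<sigma>2"
  "descending_step sel" remaining "\<lambda>x. set (fst x)"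
proof unfold_locales
  show "countable states"
    unfolding states_def using finite_openings finite_edges finite_Ori
    by (intro countable_finite finite_cartesian_product) simp_all
  show "descending_continues \<sigma>1 \<sigma>2 v x = descending_continues \<sigma>1 \<sigma>2 v' x"
    "descending_step sel v x = descending_step sel v' x"
    if "\<And>b. b \<in> set (fst x) \<Longrightarrow> v b = v' b" for v v' x
    using observe_cong[of "fst x" v v'] that
    by (cases x; simp add: descending_continues_def descending_step_def)+
  show "set (fst (descending_step sel v x)) = set (fst x)
    \<or> (\<exists>b. set (fst (descending_step sel v x)) = insert b (set (fst x)))" for v x
    by (cases x) (auto simp: descending_step_eq Let_def simp del: split_paired_Ex)
  show "descending_step sel v x \<in> states" "remaining (descending_step sel v x) < remaining x"
    if "x \<in> states" "descending_continues \<sigma>1 \<sigma>2 v x" for v x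
    using that descending_step_in_states remaining_descending_step by (cases x; simp)+
qed (simp_all add: descending_advance_measurable, simp add: states_def openings_def)

definition reachable ::
    "'v realization \<Rightarrow> ('v \<times> 'v) list \<Rightarrow> ('v \<times> 'v) set \<Rightarrow> 'v set set \<Rightarrow> bool" where
  "reachable v bs S M \<longleftrightarrow> v \<in> space joint_law \<and> (\<exists>n. trajectory n v = (bs, S, M))"

lemma reachable_in_states: "reachable v bs S M \<Longrightarrow> (bs, S, M) \<in> states"
  unfolding reachable_def by (metis trajectory_in)

lemma reachable_subset_Ori: "reachable v bs S M \<Longrightarrow> S \<subseteq> Ori"
  using reachable_in_states by (simp add: states_def)

lemma reachable_induct [consumes 1, case_names start open_box match]:
  assumes reachable: "reachable v bs S M"
    and start: "Q [] Ori {}"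
    and open_box: "\<And>bs S M b. reachable v bs S M \<Longrightarrow> Q bs S M \<Longrightarrow> selected v bs S b \<Longrightarrow> b \<in> Ori \<Longrightarrow>
      \<not> {b, prod.swap b} \<subseteq> set bs \<Longrightarrow> Q (bs @ [pending_box bs b]) S M"
    and match: "\<And>bs S M b. reachable v bs S M \<Longrightarrow> Q bs S M \<Longrightarrow> selected v bs S b \<Longrightarrow> b \<in> Ori \<Longrightarrow>
      {b, prod.swap b} \<subseteq> set bs \<Longrightarrow> Q bs {d \<in> S. edge d \<inter> edge b = {}} (insert (edge b) M)"
  shows "Q bs S M"
proof -
  obtain n where in_space: "v \<in> space joint_law" and time: "trajectory n v = (bs, S, M)"
    using reachable by (auto simp: reachable_def)
  from time show ?thesis
  proof (induction n arbitrary: bs S M)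
    case 0
    then show ?case using start by simp
  next
    case (Suc n)
    obtain bs' S' M' where previous: "trajectory n v = (bs', S', M')" by (cases "trajectory n v")
    have reachable': "reachable v bs' S' M'" using in_space previous by (auto simp: reachable_def)
    show ?case
    proof (cases "descending_continues \<sigma>1 \<sigma>2 v (bs', S', M')")
      case True
      then have step: "descending_step sel v (bs', S', M') = (bs, S, M)"
        using Suc.prems by (simp only: trajectory_Suc advance_def previous if_True)
      from reachable_in_states[OF reachable'] True show ?thesis
        by (cases rule: descending_step_cases)
          (use step open_box[OF reachable' Suc.IH[OF previous]]
            match[OF reachable' Suc.IH[OF previous]] in auto)
    next
      case False
      then show ?thesis
        using Suc.IH[of bs S M] Suc.prems previous
        by (simp only: trajectory_Suc advance_def if_False)
    qed
  qed
qed

lemma index_open_box: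
  assumes "b \<in> Ori" "d \<in> Ori" "d \<noteq> b"
  shows "index v (bs @ [pending_box bs b]) d = index v bs d"
proof -
  have "d \<noteq> prod.swap b" "prod.swap d \<noteq> b" "prod.swap d \<noteq> prod.swap b"
    using assms Ori_swap_neq[of b d] Ori_swap_neq[of d b] by (auto simp: inj_eq[OF inj_swap])
  then show ?thesis
    using assms by (auto simp: index_def pending_box_def)
qed

lemma past_indices_open_box:
  assumes "b \<in> Ori" "d \<in> Ori" "\<not> {b, prod.swap b} \<subseteq> set bs"
  shows "past_indices v (bs @ [pending_box bs b]) d
    = (if d = b then insert (index v bs b) (past_indices v bs b) else past_indices v bs d)"
proof -
  have "d \<noteq> prod.swap b" "prod.swap d \<noteq> b" "d \<noteq> b \<Longrightarrow> prod.swap d \<noteq> prod.swap b"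
    using assms Ori_swap_neq[of b d] Ori_swap_neq[of d b] by (auto simp: inj_eq[OF inj_swap])
  then show ?thesis
    using assms by (auto simp: index_def past_indices_def pending_box_def)
qed

lemma swap_opened_later:
  assumes "reachable v bs S M" "b \<in> Ori" "prod.swap b \<in> set bs"
  shows "b \<in> set bs"
  using assms
proof (induction rule: reachable_induct)
  case (open_box bs S M d)
  then show ?case
    using Ori_swap_neq[of b d]
    by (cases "b = d") (auto simp: pending_box_def inj_eq[OF inj_swap] split: if_splits)
qed auto

lemma matched_both_open:
  assumes "reachable v bs S M" "b \<in> Ori" "edge b \<in> M"
  shows "{b, prod.swap b} \<subseteq> set bs"
  using assms by (induction rule: reachable_induct) (auto dest: edge_inj_on_Ori)

lemma past_index_nonneg:
  assumes "reachable v bs S M" "b \<in> Ori" "t \<in> past_indices v bs b"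
  shows "0 \<le> t"
  using assms
proof (induction rule: reachable_induct)
  case start
  then show ?case by (simp add: past_indices_def)
next
  case (open_box bs S M d)
  then show ?case
    by (auto simp: past_indices_open_box selected_def split: if_splits)
qed

lemma \<kappa>1_le_past_index:
  assumes "reachable v bs S M" "b \<in> S" "d \<in> S" "t \<in> past_indices v bs b"
  shows "ereal (\<kappa>1 d v) \<le> t"
  using assms
proof (induction rule: reachable_induct)
  case start
  then show ?case by (simp add: past_indices_def)
next
  case (open_box bs S M c)
  have subset: "S \<subseteq> Ori" by (rule reachable_subset_Ori[OF open_box(1)])
  have "ereal (\<kappa>1 d v) \<le> index v bs d"
    using open_box.prems subset Ori_boxes by (intro \<kappa>1_le_index) auto
  also have "\<dots> \<le> index v bs c"
    using open_box by (auto simp: selected_def)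
  finally have "ereal (\<kappa>1 d v) \<le> index v bs c" .
  moreover have "b \<in> Ori" using open_box.prems subset by blast
  ultimately show ?case
    using open_box past_indices_open_box[OF open_box.hyps(3) _ open_box.hyps(4), of b]
    by (auto split: if_splits)
qed auto

lemma matched_\<kappa>1_nonneg:
  assumes "reachable v bs S M" "b \<in> Ori" "edge b \<in> M"
  shows "0 \<le> \<kappa>1 b v"
  using assms
proof (induction rule: reachable_induct)
  case (match bs S M c)
  show ?case
  proof (cases "b = c")
    case True
    have "0 \<le> ereal (\<kappa>1 c v)"
      using match Ori_boxes past_index_nonneg[OF match(1), of c]
      by (intro le_\<kappa>1_if_both_open) (auto simp: selected_def)
    then show ?thesis by (simp add: True)
  next
    case False
    then show ?thesis using match edge_inj_on_Ori[of b c] by auto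
  qed
qed auto

lemma removed_dominated:
  assumes "reachable v bs S M" "d \<in> Ori" "d \<notin> S"
  shows "\<exists>b \<in> Ori. edge b \<in> M \<and> edge d \<inter> edge b \<noteq> {} \<and> \<kappa>1 d v \<le> \<kappa>1 b v"
  using assms
proof (induction rule: reachable_induct)
  case (match bs S M c)
  show ?case
  proof (cases "d \<in> S")
    case True
    have "ereal (\<kappa>1 d v) \<le> ereal (\<kappa>1 c v)"
    proof (rule le_\<kappa>1_if_both_open)
      show "ereal (\<kappa>1 d v) \<le> t" if "t \<in> past_indices v bs c" for t
        using \<kappa>1_le_past_index[OF match.hyps(1) _ True that] \<open>selected v bs S c\<close>
        by (simp add: selected_def)
      have "ereal (\<kappa>1 d v) \<le> index v bs d"
        using match.prems Ori_boxes by (intro \<kappa>1_le_index) auto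
      also have "\<dots> \<le> index v bs c"
        using \<open>selected v bs S c\<close> True by (simp add: selected_def)
      finally show "ereal (\<kappa>1 d v) \<le> index v bs c" .
    qed (use match Ori_boxes in auto)
    then show ?thesis
      using match True by (intro bexI[of _ c]) auto
  next
    case False
    then show ?thesis using match.IH match.prems by blast
  qed
qed auto

text \<open>
  A basket whose index has risen above a value \<open>t\<close> at which it was advanced has no competitor
  above \<open>t\<close>, so it is the next one to be advanced.
\<close>

definition urgent ::
    "'v realization \<Rightarrow> ('v \<times> 'v) list \<Rightarrow> ('v \<times> 'v) set \<Rightarrow> 'v \<times> 'v \<Rightarrow> ereal \<Rightarrow> bool" where
  "urgent v bs S b t \<longleftrightarrow> b \<in> S \<and> t < index v bs b \<and> (\<forall>d \<in> S - {b}. index v bs d \<le> t)"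

lemma urgent_unique_selected:
  assumes "urgent v bs S b t" "selected v bs S c"
  shows "b = c"
proof (rule ccontr)
  assume "b \<noteq> c"
  with assms have "index v bs c \<le> t" "t < index v bs b" "index v bs b \<le> index v bs c"
    by (auto simp: urgent_def selected_def)
  then show False by simp
qed

lemma urgent_open_box:
  assumes "selected v bs S b" "b \<in> Ori" "S \<subseteq> Ori"
    and "t < index v (bs @ [pending_box bs b]) b" and "index v bs b \<le> t \<or> urgent v bs S b t"
  shows "urgent v (bs @ [pending_box bs b]) S b t"
proof -
  have "index v (bs @ [pending_box bs b]) d \<le> t" if competitor: "d \<in> S - {b}" for d
  proof -
    have "index v bs d \<le> index v bs b"
      using assms(1) competitor by (simp add: selected_def)
    then have "index v bs d \<le> t"
      using assms(5) competitor by (auto simp: urgent_def intro: order_trans)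
    moreover have "index v (bs @ [pending_box bs b]) d = index v bs d"
      using assms(2,3) competitor by (intro index_open_box) auto
    ultimately show ?thesis by simp
  qed
  then show ?thesis using assms(1,4) by (simp add: urgent_def selected_def)
qed

lemma risen_index_urgent:
  assumes "reachable v bs S M" "b \<in> Ori" "edge b \<notin> M" "t \<in> past_indices v bs b" "t < index v bs b"
  shows "urgent v bs S b t"
  using assms
proof (induction rule: reachable_induct)
  case start
  then show ?case by (simp add: past_indices_def)
next
  case (open_box bs S M c)
  have "b = c"
  proof (rule ccontr)
    assume "b \<noteq> c"
    then have "urgent v bs S b t"
      using open_box index_open_box[of c b] by (auto simp: past_indices_open_box)
    then show False using urgent_unique_selected \<open>selected v bs S c\<close> \<open>b \<noteq> c\<close> by blast
  qed
  moreover have "index v bs c \<le> t \<or> urgent v bs S c t"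
    using open_box \<open>b = c\<close>
    by (cases "index v bs c \<le> t") (auto simp: past_indices_open_box not_le)
  ultimately show ?case
    using open_box reachable_subset_Ori[OF open_box.hyps(1)] urgent_open_box[of v bs S c t]
    by simp
next
  case (match bs S M c)
  then have "b \<noteq> c" "urgent v bs S b t" by auto
  then show ?case using urgent_unique_selected \<open>selected v bs S c\<close> by blast
qed

lemma final_state:
  assumes "v \<in> space joint_law"
  obtains bs S M where "final v = (bs, S, M)" "reachable v bs S M" "\<forall>d \<in> S. index v bs d < 0"
    "run_descending \<sigma>1 \<sigma>2 sel Ori v = (bs, M)"
proof -
  obtain bs S M where final_eq: "final v = (bs, S, M)" by (cases "final v")
  have reachable: "reachable v bs S M"
    using assms final_eq final_eq_trajectory[OF assms order_refl] by (auto simp: reachable_def)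
  show ?thesis
  proof (rule that)
    show "\<forall>d \<in> S. index v bs d < 0"
      using not_continue_final[OF assms]
        descending_continues_iff[OF reachable_subset_Ori[OF reachable]]
      by (auto simp: final_eq not_le)
    show "run_descending \<sigma>1 \<sigma>2 sel Ori v = (bs, M)"
      using final_eq by (simp add: run_descending_def final_def)
  qed (fact final_eq reachable)+
qed

lemma not_opened_first_swap:
  assumes in_space: "v \<in> space joint_law" and oriented: "b \<in> Ori"
  shows "\<not> opened_first (prod.swap b) v"
proof
  assume swap: "opened_first (prod.swap b) v"
  then obtain n where time: "set (fst (trajectory n v)) \<inter> {b, prod.swap b} = {}"
    "prod.swap b \<in> set (fst (trajectory (Suc n) v))"
    unfolding opened_first_swap opened_before_def by blast
  obtain bs S M where next_state: "trajectory (Suc n) v = (bs, S, M)"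
    by (cases "trajectory (Suc n) v")
  then have "b \<in> set bs"
    using swap_opened_later[of v bs S M b] in_space oriented time by (auto simp: reachable_def)
  then have "opened_first b v"
    using time next_state unfolding opened_first_def opened_before_def by (intro exI[of _ n]) simp
  then show False using swap opened_first_exclusive[of b v] oriented Ori_boxes by blast
qed

definition matched :: "'v realization \<Rightarrow> ('v \<times> 'v) set" where
  "matched v = {b \<in> Ori. edge b \<in> snd (snd (final v))}"

definition greedy_weight :: "'v realization \<Rightarrow> real" where
  "greedy_weight v = (\<Sum>b \<in> matched v. \<kappa>1 b v)"

lemma greedy_weight_eq: "greedy_weight v = (\<Sum>b \<in> Box. of_bool (b \<in> matched v) * \<kappa>1 b v)"
proof -
  have "Box \<inter> {b. b \<in> matched v} = matched v" using Ori_boxes by (auto simp: matched_def)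
  then show ?thesis using finite_boxes by (simp add: greedy_weight_def)
qed

lemma greedy_weight_integrable: "integrable joint_law greedy_weight"
proof -
  have "integrable joint_law (\<lambda>v. of_bool (b \<in> matched v) * \<kappa>1 b v)" if box: "b \<in> Box" for b
  proof (rule Bochner_Integration.integrable_bound[OF \<kappa>1_integrable[OF box]])
    have [measurable]: "Measurable.pred joint_law (\<lambda>v. b \<in> matched v)"
      unfolding matched_def mem_Collect_eq by (rule measurable_compose[OF final_measurable]) simp
    show "(\<lambda>v. of_bool (b \<in> matched v) * \<kappa>1 b v) \<in> borel_measurable joint_law"
      using \<kappa>1_measurable[OF box] by measurable
  qed auto
  then show ?thesis
    unfolding greedy_weight_eq[abs_def] by (rule Bochner_Integration.integrable_sum)
qed

lemma amortized_payoff_unmatched: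
  assumes in_space: "v \<in> space joint_law" and final_eq: "final v = (bs, S, M)"
    and unmatched: "b \<in> Ori" "edge b \<notin> M"
  shows "amortized_payoff M v b = 0"
proof -
  have reachable: "reachable v bs S M" and stopped: "\<forall>d \<in> S. index v bs d < 0"
    using final_state[OF in_space] final_eq by auto
  have box: "b \<in> Box" using unmatched Ori_boxes by blast
  have settled: "index v bs b \<le> t" if past: "t \<in> past_indices v bs b" for t
  proof (rule ccontr)
    assume "\<not> index v bs b \<le> t"
    then have "b \<in> S"
      using risen_index_urgent[OF reachable unmatched past] by (simp add: urgent_def)
    then show False
      using stopped past_index_nonneg[OF reachable unmatched(1) past] \<open>\<not> index v bs b \<le> t\<close>
      by (meson less_imp_le order_trans)
  qed
  have "\<kappa>1 b v = \<kappa>2 b v" if "opened_first b v"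
    using opened_first_imp_opened[OF in_space that] settled
    by (intro \<kappa>1_eq_\<kappa>2_if_index_le_past[OF box]) (auto simp: opened_def final_eq)
  moreover have "\<kappa>2 b v = \<kappa>3 b v" if "completed b v"
    using that opened_first_imp_opened[OF in_space, of b] settled
    by (intro \<kappa>2_eq_\<kappa>3_if_index_le_past[OF box]) (auto simp: completed_def opened_def final_eq)
  ultimately show ?thesis using unmatched by (simp add: amortized_payoff_def)
qed

lemma matched_opened:
  assumes "v \<in> space joint_law" "b \<in> matched v"
  shows "opened b v" "opened (prod.swap b) v"
proof -
  obtain bs S M where final_eq: "final v = (bs, S, M)" and reachable: "reachable v bs S M"
    by (rule final_state[OF assms(1)])
  then show "opened b v" "opened (prod.swap b) v"
    using matched_both_open[OF reachable, of b] assms(2) by (simp_all add: matched_def opened_def)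
qed

lemma amortized_payoff_eq:
  assumes in_space: "v \<in> space joint_law" and final_eq: "final v = (bs, S, M)" and box: "b \<in> Box"
  shows "amortized_payoff M v b = of_bool (b \<in> matched v) * \<kappa>1 b v"
proof (cases "b \<in> Ori")
  case True
  have "completed b v" if "b \<in> matched v"
    using matched_opened[OF in_space that] opened_first_total[OF in_space, of b]
      not_opened_first_swap[OF in_space True]
    by (auto simp: completed_def)
  then show ?thesis
    using amortized_payoff_unmatched[OF in_space final_eq True] True
    by (auto simp: matched_def final_eq amortized_payoff_matched)
next
  case False
  then have "\<not> opened_first b v"
    using not_opened_first_swap[OF in_space, of "prod.swap b"] swap_in_Ori_iff[OF box] by simp
  with False show ?thesis
    by (simp add: amortized_payoff_def completed_def matched_def)
qed

lemma payoff_add_gap_eq_greedy_weight: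
  assumes in_space: "v \<in> space joint_law"
  shows "payoff P v (run_descending \<sigma>1 \<sigma>2 sel Ori v) + amortization_gap v = greedy_weight v"
proof -
  obtain bs S M where final_eq: "final v = (bs, S, M)" and reachable: "reachable v bs S M"
    and run: "run_descending \<sigma>1 \<sigma>2 sel Ori v = (bs, M)"
    by (rule final_state[OF in_space])
  have "payoff P v (bs, M) + amortization_gap v = (\<Sum>b \<in> Box. amortized_payoff M v b)"
  proof (rule payoff_add_amortization_gap[OF in_space])
    fix b assume in_matching: "edge b \<in> M"
    then have "b \<in> Box"
      using reachable_in_states[OF reachable] by (auto simp: states_def boxes_iff)
    then have "b \<in> matched v \<or> prod.swap b \<in> matched v"
      using in_matching swap_in_Ori_iff[of b]
      unfolding matched_def final_eq mem_Collect_eq snd_conv edge_swap by blast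
    then show "opened b v"
      using matched_opened[OF in_space, of b] matched_opened[OF in_space, of "prod.swap b"] by auto
  qed (simp add: opened_def final_eq)
  also have "\<dots> = (\<Sum>b \<in> Box. of_bool (b \<in> matched v) * \<kappa>1 b v)"
    by (intro sum.cong refl amortized_payoff_eq[OF in_space final_eq])
  also have "\<dots> = greedy_weight v" by (rule greedy_weight_eq[symmetric])
  finally show ?thesis by (simp add: run)
qed

lemma descending_welfare_eq:
  "descending_welfare P \<sigma>1 \<sigma>2 sel Ori = (\<integral>v. greedy_weight v \<partial>joint_law)"
proof -
  have "descending_welfare P \<sigma>1 \<sigma>2 sel Ori = (\<integral>v. greedy_weight v - amortization_gap v \<partial>joint_law)"
    unfolding descending_welfare_def value_measure_eq
    by (intro Bochner_Integration.integral_cong)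
      (auto simp: payoff_add_gap_eq_greedy_weight[symmetric])
  then show ?thesis
    using greedy_weight_integrable amortization_gap_mean_zero
    by (simp add: has_bochner_integral_iff)
qed

lemma disjoint_family_weight_le_greedy:
  assumes in_space: "v \<in> space joint_law" and family: "T \<subseteq> Ori" "disjoint_family_on edge T"
  shows "(\<Sum>b \<in> T. \<kappa>1 b v) \<le> 2 * greedy_weight v"
proof -
  obtain bs S M where final_eq: "final v = (bs, S, M)" and reachable: "reachable v bs S M"
    and stopped: "\<forall>d \<in> S. index v bs d < 0"
    by (rule final_state[OF in_space])
  have "(\<Sum>b \<in> T. \<kappa>1 b v) \<le> real 2 * (\<Sum>b \<in> matched v. \<kappa>1 b v)"
  proof (rule disjoint_family_weight_le_dominating)
    show "0 \<le> \<kappa>1 g v" if "g \<in> matched v" for g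
      using that matched_\<kappa>1_nonneg[OF reachable] by (simp add: matched_def final_eq)
    show "finite (edge g) \<and> card (edge g) \<le> 2" if "g \<in> matched v" for g
      using that card_edge[of g] Ori_boxes by (auto simp: matched_def)
    show "\<exists>g \<in> matched v. edge b \<inter> edge g \<noteq> {} \<and> \<kappa>1 b v \<le> \<kappa>1 g v"
      if candidate: "b \<in> T" "0 \<le> \<kappa>1 b v" for b
    proof -
      have "0 \<le> ereal (\<kappa>1 b v)" using candidate by simp
      also have "\<dots> \<le> index v bs b"
        using candidate family Ori_boxes by (intro \<kappa>1_le_index) auto
      finally have "b \<notin> S" using stopped by (meson not_less)
      then show ?thesis
        using removed_dominated[OF reachable, of b] candidate family
        unfolding matched_def final_eq snd_conv by blast
    qed
    show "finite T" by (rule finite_subset[OF family(1) finite_Ori])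
    show "finite (matched v)" using finite_Ori by (simp add: matched_def)
  qed (fact family(2))
  then show ?thesis by (simp add: greedy_weight_def)
qed

end

section \<open>The approximation guarantee\<close>

lemma (in pandora_indices) welfare_le_descending:
  fixes R :: "'s measure"
  assumes "prob_space R" "is_algorithm P R \<pi>"
    and "is_selection P \<sigma>1 \<sigma>2 sel" and orientation: "is_orientation P Ori"
  shows "welfare P R \<pi> \<le> 2 * descending_welfare P \<sigma>1 \<sigma>2 sel Ori
    + 2 * descending_welfare P \<sigma>1 \<sigma>2 sel (Ori\<inverse>)"
proof -
  interpret O: descending P \<sigma>1 \<sigma>2 sel Ori by unfold_locales fact+
  interpret O': descending P \<sigma>1 \<sigma>2 sel "Ori\<inverse>"
    by unfold_locales (fact, rule is_orientation_converse[OF orientation])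
  define G where "G v = 2 * O.greedy_weight v + 2 * O'.greedy_weight v" for v
  have "welfare P R \<pi> \<le> (\<integral>v. G v \<partial>joint_law)"
  proof (rule welfare_le[OF assms(1,2)])
    show "integrable joint_law G"
      unfolding G_def using O.greedy_weight_integrable O'.greedy_weight_integrable by simp
    show "bounds_matching_weight G"
      unfolding bounds_matching_weight_def
    proof (intro ballI allI impI)
      fix v T
      assume in_space: "v \<in> space joint_law" and family: "T \<subseteq> Box" "disjoint_family_on edge T"
      have "T - Ori \<subseteq> Ori\<inverse>"
        using family(1) O.swap_in_Ori_iff
        by (auto simp: mem_converse_iff_swap simp del: converse_iff)
      moreover have "finite T" by (rule finite_subset[OF family(1) finite_boxes])
      ultimately have "(\<Sum>b \<in> T. \<kappa>1 b v) \<le> 2 * O.greedy_weight v + 2 * O'.greedy_weight v"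
        using in_space family(2) unfolding sum.Int_Diff[OF \<open>finite T\<close>, of _ Ori]
        by (intro add_mono O.disjoint_family_weight_le_greedy O'.disjoint_family_weight_le_greedy)
          (auto simp: disjoint_family_on_def)
      then show "(\<Sum>b \<in> T. \<kappa>1 b v) \<le> G v" by (simp add: G_def)
    qed
  qed
  also have "\<dots> = 2 * descending_welfare P \<sigma>1 \<sigma>2 sel Ori
      + 2 * descending_welfare P \<sigma>1 \<sigma>2 sel (Ori\<inverse>)"
    unfolding G_def O.descending_welfare_eq O'.descending_welfare_eq
    using O.greedy_weight_integrable O'.greedy_weight_integrable by simp
  finally show ?thesis .
qed

theorem theorem2:
  fixes P :: "'v pandora"
    and R :: "'s measure"
    and \<sigma>1 :: "'v \<times> 'v \<Rightarrow> ereal"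
    and \<sigma>2 :: "'v \<times> 'v \<Rightarrow> real \<Rightarrow> ereal"
    and sel :: "'v history \<Rightarrow> ('v \<times> 'v) set \<Rightarrow> 'v \<times> 'v"
    and Ori :: "('v \<times> 'v) set"
  assumes "pandora_instance P"
    and "prob_space R"
    and "are_indices P \<sigma>1 \<sigma>2"
    and "is_selection P \<sigma>1 \<sigma>2 sel"
    and "is_orientation P Ori"
  shows "ereal (best_of_two_worlds_welfare P \<sigma>1 \<sigma>2 sel Ori) \<ge> ereal (1 / 4) * opt_welfare P R"
proof -
  let ?w = "descending_welfare P \<sigma>1 \<sigma>2 sel"
  interpret pandora_indices P \<sigma>1 \<sigma>2 by unfold_locales fact+
  have "opt_welfare P R \<le> ereal (2 * ?w Ori + 2 * ?w (Ori\<inverse>))"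
    unfolding opt_welfare_def using welfare_le_descending assms by (intro SUP_least) auto
  then have "ereal (1 / 4) * opt_welfare P R \<le> ereal (1 / 4) * ereal (2 * ?w Ori + 2 * ?w (Ori\<inverse>))"
    by (rule ereal_mult_left_mono) simp
  also have "\<dots> \<le> ereal (max (?w Ori) (?w (Ori\<inverse>)))"
    by (simp add: max_def)
  also have "max (?w Ori) (?w (Ori\<inverse>)) = best_of_two_worlds_welfare P \<sigma>1 \<sigma>2 sel Ori"
    by (simp add: best_of_two_worlds_welfare_def run_best_of_two_worlds_def
        descending_welfare_def max_def)
  finally show ?thesis .
qed

end
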